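(* Let $f$ be a $*$-identity of $M_{1,2}(F)$ of degree at most $3$. Then $f$ belongs to the $T_2^*$-ideal of the free $*$-superalgebra generated by the set $\mathcal{I}$ consisting of the $*$-polynomials $[y_1^+,y_2^+]$, $[y_1^+,y_1^-]$, $y_1^-z_1^+y_2^-$, $y_1^-z_1^-y_2^-$, $z_1^+z_2^+z_3^++z_2^+z_3^+z_1^++z_3^+z_1^+z_2^+$, $z_1^-z_2^-z_3^-+z_2^-z_3^-z_1^-+z_3^-z_1^-z_2^-$, $z_1^+y_1^-z_2^+-z_2^+y_1^-z_1^+$, $z_1^-y_1^-z_2^--z_2^-y_1^-z_1^-$, $z_1^+z_2^+z_1^--z_2^+z_1^-z_1^++z_1^-z_1^+z_2^+$, $z_1^-z_2^-z_1^+-z_2^-z_1^+z_1^-+z_1^+z_1^-z_2^-$, $z_1^+y_1^-z_1^-+z_1^-y_1^-z_1^+$.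
   Context: $F$ is a field of characteristic zero. $M_{1,2}(F)$ is the algebra of $3\times 3$ matrices over $F$ with $\mathbb{Z}_2$-grading whose even part is spanned by $e_{11},e_{22},e_{23},e_{32},e_{33}$ and odd part by $e_{12},e_{13},e_{21},e_{31}$, with the orthosymplectic superinvolution $*$ sending the matrix with rows $(a,b,c),(d,e,f),(g,h,i)$ to the matrix with rows $(a,-g,d),(c,i,-f),(-b,-h,e)$ (a superinvolution is a grading-preserving linear map with $(a^* )^*=a$ and $(ab)^*=(-1)^{|a||b|}b^*a^*$). The free $*$-superalgebra is the free associative algebra on variables $y_i^+$ (even, symmetric), $y_i^-$ (even, skew), $z_i^+$ (odd, symmetric), $z_i^-$ (odd, skew), $i\ge 1$, with the grading and the superinvolution determined by these labels. A $*$-polynomial is a $*$-identity of $M_{1,2}(F)$ if it vanishes under every substitution of $y_i^+,y_i^-,z_i^+,z_i^-$ by elements of the even symmetric, even skew, odd symmetric, odd skew parts of $M_{1,2}(F)$, respectively. A $T_2^*$-ideal is an ideal of the free $*$-superalgebra invariant under all grading-preserving endomorphisms commuting with the superinvolution. $[a,b]=ab-ba$. *)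

theory Defs
  imports "HOL-Analysis.Analysis" "HOL-Library.Poly_Mapping"
begin

text \<open>Kinds of variables: YP = y^+ (even, symmetric), YM = y^- (even, skew),
  ZP = z^+ (odd, symmetric), ZM = z^- (odd, skew).\<close>
datatype vkind = YP | YM | ZP | ZM

type_synonym var = "vkind \<times> nat"

definition kodd :: "vkind \<Rightarrow> bool" where
  "kodd k \<longleftrightarrow> k = ZP \<or> k = ZM"

definition ksign :: "vkind \<Rightarrow> int" where
  "ksign k = (if k = YP \<or> k = ZP then 1 else -1)"

text \<open>Words (monomials) in the variables; the free monoid, written additively
  so that the monoid algebra of Poly_Mapping is the free associative algebra.\<close>
datatype word = W "var list"

fun wlist :: "word \<Rightarrow> var list" where
  "wlist (W xs) = xs"

instantiation word :: monoid_add
begin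
fun plus_word :: "word \<Rightarrow> word \<Rightarrow> word" where
  "plus_word (W a) (W b) = W (a @ b)"
definition zero_word :: word where
  "zero_word = W []"
instance
proof
  fix a b c :: word
  show "a + b + c = a + (b + c)" by (cases a; cases b; cases c) simp
  show "0 + a = a" by (cases a) (simp add: zero_word_def)
  show "a + 0 = a" by (cases a) (simp add: zero_word_def)
qed
end

text \<open>The free associative algebra F<X> over F with basis the words
  (this type is a ring_1 via the Poly_Mapping monoid-algebra instance).\<close>
type_synonym 'a fpoly = "word \<Rightarrow>\<^sub>0 'a"

definition fvar :: "vkind \<Rightarrow> nat \<Rightarrow> 'a::ring_1 fpoly" where
  "fvar k i = Poly_Mapping.single (W [(k, i)]) 1"

abbreviation "yp i \<equiv> fvar YP i"
abbreviation "ym i \<equiv> fvar YM i"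
abbreviation "zp i \<equiv> fvar ZP i"
abbreviation "zm i \<equiv> fvar ZM i"

definition fsmult :: "'a::ring_1 \<Rightarrow> 'a fpoly \<Rightarrow> 'a fpoly" where
  "fsmult c p = Poly_Mapping.single 0 c * p"

definition nodd :: "word \<Rightarrow> nat" where
  "nodd w = length (filter (\<lambda>x. kodd (fst x)) (wlist w))"

definition wdeg :: "word \<Rightarrow> nat" where
  "wdeg w = length (wlist w)"

text \<open>Superinvolution on the free algebra: for a monomial x_1...x_n,
  (x_1...x_n)^* = (-1)^(k choose 2) * (prod of signs) * x_n ... x_1,
  k the number of odd letters (forced by (ab)^* = (-1)^{|a||b|} b^* a^*).\<close>
definition wsign :: "word \<Rightarrow> int" where
  "wsign w = (-1) ^ (nodd w choose 2) * prod_list (map (\<lambda>x. ksign (fst x)) (wlist w))"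

definition wrev :: "word \<Rightarrow> word" where
  "wrev w = W (rev (wlist w))"

definition fstar :: "'a::ring_1 fpoly \<Rightarrow> 'a fpoly" where
  "fstar p = (\<Sum>w\<in>Poly_Mapping.keys p. Poly_Mapping.single (wrev w) (of_int (wsign w) * Poly_Mapping.lookup p w))"

definition fpoly_even :: "'a::ring_1 fpoly \<Rightarrow> bool" where
  "fpoly_even p \<longleftrightarrow> (\<forall>w\<in>Poly_Mapping.keys p. even (nodd w))"

definition fpoly_odd :: "'a::ring_1 fpoly \<Rightarrow> bool" where
  "fpoly_odd p \<longleftrightarrow> (\<forall>w\<in>Poly_Mapping.keys p. odd (nodd w))"

definition star_graded_endo :: "('a::ring_1 fpoly \<Rightarrow> 'a fpoly) \<Rightarrow> bool" where
  "star_graded_endo \<phi> \<longleftrightarrow>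
     (\<forall>p q. \<phi> (p + q) = \<phi> p + \<phi> q) \<and>
     (\<forall>c p. \<phi> (fsmult c p) = fsmult c (\<phi> p)) \<and>
     (\<forall>p q. \<phi> (p * q) = \<phi> p * \<phi> q) \<and>
     (\<forall>p. fpoly_even p \<longrightarrow> fpoly_even (\<phi> p)) \<and>
     (\<forall>p. fpoly_odd p \<longrightarrow> fpoly_odd (\<phi> p)) \<and>
     (\<forall>p. \<phi> (fstar p) = fstar (\<phi> p))"

definition is_T2star_ideal :: "'a::ring_1 fpoly set \<Rightarrow> bool" where
  "is_T2star_ideal J \<longleftrightarrow>
     0 \<in> J \<and>
     (\<forall>p\<in>J. \<forall>q\<in>J. p + q \<in> J) \<and>
     (\<forall>c. \<forall>p\<in>J. fsmult c p \<in> J) \<and>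
     (\<forall>a. \<forall>p\<in>J. a * p \<in> J \<and> p * a \<in> J) \<and>
     (\<forall>\<phi>. star_graded_endo \<phi> \<longrightarrow> (\<forall>p\<in>J. \<phi> p \<in> J))"

definition T2star_ideal_gen :: "'a::ring_1 fpoly set \<Rightarrow> 'a fpoly set" where
  "T2star_ideal_gen S = \<Inter>{J. is_T2star_ideal J \<and> S \<subseteq> J}"

text \<open>3x3 matrices as a^3^3; indices 1,2,3 of the numeral type 3
  (where the literal 3 denotes the third index).\<close>

definition M12_even :: "'a::field ^3^3 \<Rightarrow> bool" where
  "M12_even A \<longleftrightarrow> A$1$2 = 0 \<and> A$1$3 = 0 \<and> A$2$1 = 0 \<and> A$3$1 = 0"

definition M12_odd :: "'a::field ^3^3 \<Rightarrow> bool" where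
  "M12_odd A \<longleftrightarrow> A$1$1 = 0 \<and> A$2$2 = 0 \<and> A$2$3 = 0 \<and> A$3$2 = 0 \<and> A$3$3 = 0"

definition M12_star :: "'a::field ^3^3 \<Rightarrow> 'a^3^3" where
  "M12_star A = (\<chi> i j.
     if i = 1 \<and> j = 1 then A$1$1 else
     if i = 1 \<and> j = 2 then - A$3$1 else
     if i = 1 \<and> j = 3 then A$2$1 else
     if i = 2 \<and> j = 1 then A$1$3 else
     if i = 2 \<and> j = 2 then A$3$3 else
     if i = 2 \<and> j = 3 then - A$2$3 else
     if i = 3 \<and> j = 1 then - A$1$2 else
     if i = 3 \<and> j = 2 then - A$3$2 else A$2$2)"

definition M12_admissible :: "(var \<Rightarrow> 'a::field ^3^3) \<Rightarrow> bool" where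
  "M12_admissible \<sigma> \<longleftrightarrow> (\<forall>i.
     (M12_even (\<sigma> (YP, i)) \<and> M12_star (\<sigma> (YP, i)) = \<sigma> (YP, i)) \<and>
     (M12_even (\<sigma> (YM, i)) \<and> M12_star (\<sigma> (YM, i)) = - \<sigma> (YM, i)) \<and>
     (M12_odd (\<sigma> (ZP, i)) \<and> M12_star (\<sigma> (ZP, i)) = \<sigma> (ZP, i)) \<and>
     (M12_odd (\<sigma> (ZM, i)) \<and> M12_star (\<sigma> (ZM, i)) = - \<sigma> (ZM, i)))"

definition eval_word :: "(var \<Rightarrow> 'a::field ^3^3) \<Rightarrow> word \<Rightarrow> 'a^3^3" where
  "eval_word \<sigma> w = foldr (\<lambda>x A. \<sigma> x ** A) (wlist w) (mat 1)"

definition eval_fpoly :: "(var \<Rightarrow> 'a::field ^3^3) \<Rightarrow> 'a fpoly \<Rightarrow> 'a^3^3" where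
  "eval_fpoly \<sigma> p = (\<Sum>w\<in>Poly_Mapping.keys p. (\<chi> i j. Poly_Mapping.lookup p w * (eval_word \<sigma> w)$i$j))"

definition is_M12_star_identity :: "'a::field fpoly \<Rightarrow> bool" where
  "is_M12_star_identity f \<longleftrightarrow> (\<forall>\<sigma>. M12_admissible \<sigma> \<longrightarrow> eval_fpoly \<sigma> f = 0)"

definition fdeg_le :: "'a::ring_1 fpoly \<Rightarrow> nat \<Rightarrow> bool" where
  "fdeg_le f d \<longleftrightarrow> (\<forall>w\<in>Poly_Mapping.keys f. wdeg w \<le> d)"

definition gens_I :: "'a::ring_1 fpoly set" where
  "gens_I = {
     yp 1 * yp 2 - yp 2 * yp 1,
     yp 1 * ym 1 - ym 1 * yp 1,
     ym 1 * zp 1 * ym 2,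
     ym 1 * zm 1 * ym 2,
     zp 1 * zp 2 * zp 3 + zp 2 * zp 3 * zp 1 + zp 3 * zp 1 * zp 2,
     zm 1 * zm 2 * zm 3 + zm 2 * zm 3 * zm 1 + zm 3 * zm 1 * zm 2,
     zp 1 * ym 1 * zp 2 - zp 2 * ym 1 * zp 1,
     zm 1 * ym 1 * zm 2 - zm 2 * ym 1 * zm 1,
     zp 1 * zp 2 * zm 1 - zp 2 * zm 1 * zp 1 + zm 1 * zp 1 * zp 2,
     zm 1 * zm 2 * zp 1 - zm 2 * zp 1 * zm 1 + zp 1 * zm 1 * zm 2,
     zp 1 * ym 1 * zm 1 + zm 1 * ym 1 * zp 1}"

end

theory Submission
  imports Defs "HOL-Combinatorics.Multiset_Permutations"
begin

text \<open>
  Let \<open>f\<close> be an identity of degree at most \<open>n\<close> and \<open>x\<^sub>0, \<dots>, x\<^sub>n\<^sub>-\<^sub>1\<close> letters, possibly equal. Replace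
  every letter \<open>x\<close> of \<open>f\<close> by the sum of the new letters \<open>y\<^sub>i\<close> with \<open>i \<in> S\<close> and \<open>x\<^sub>i = x\<close>. By
  inclusion-exclusion over \<open>S \<subseteq> {..<n}\<close>, the polynomial \<open>\<Sum>\<^sub>\<pi> f(x\<^sub>\<pi>) y\<^sub>\<pi>\<close> is a multilinear identity, where
  \<open>x\<^sub>\<pi>\<close> and \<open>y\<^sub>\<pi>\<close> are the permuted words and \<open>f(w)\<close> is the coefficient of \<open>w\<close>. Substituting \<open>x\<^sub>i\<close> for \<open>y\<^sub>i\<close> and summing over all words \<open>x\<close>
  gives \<open>n!\<close> times the component of degree \<open>n\<close> of \<open>f\<close>. In characteristic zero a \<open>T\<^sub>2\<^sup>*\<close>-ideal with all
  multilinear identities of degree \<open>n\<close> therefore contains all identities of degree at most \<open>n\<close>: those of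
  lower degree can be multiplied by a variable \<open>y\<^sup>+\<close>, for which 1 can be substituted afterwards.

  In degree three there is one family of multilinear polynomials for every multiset of three kinds. A
  few matrices determine the linear relations between the six coefficients of an identity, and these are
  the relations that follow from the generators. The only generators that need substitutions of degree 2
  are the commutators, which are applied to \<open>y\<^sub>1\<^sup>-y\<^sub>2\<^sup>- + y\<^sub>2\<^sup>-y\<^sub>1\<^sup>-\<close> and to \<open>z\<^sub>1z\<^sub>2 \<plusminus> z\<^sub>2z\<^sub>1\<close>. Up to the sign
  \<open>pair_sign\<close>, symmetric and skew odd variables behave alike.
\<close>

section \<open>The free algebra and its substitutions\<close>

lemma poly_mapping_keys_induct [consumes 1, case_names zero single add]:
  fixes p :: "'b \<Rightarrow>\<^sub>0 'a::comm_monoid_add"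
  assumes "\<forall>w\<in>Poly_Mapping.keys p. Q w"
    and "P 0"
    and "\<And>w c. Q w \<Longrightarrow> P (Poly_Mapping.single w c)"
    and "\<And>p q. P p \<Longrightarrow> P q \<Longrightarrow> P (p + q)"
  shows "P p"
  using assms(1)
proof (induction p rule: update_induct)
  case const
  show ?case by (fact assms(2))
next
  case (update p w c)
  have "Poly_Mapping.update w c p = p + Poly_Mapping.single w c"
    using update.hyps(1)
    by (intro poly_mapping_eqI) (auto simp: lookup_update lookup_add lookup_single in_keys_iff when_def)
  moreover have "Poly_Mapping.keys (Poly_Mapping.update w c p) = insert w (Poly_Mapping.keys p)"
    using update.hyps(2) by (simp add: keys_update)
  ultimately show ?case
    using update assms(3,4) by simp
qed

lemma poly_mapping_induct [case_names zero single add]: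
  fixes p :: "'b \<Rightarrow>\<^sub>0 'a::comm_monoid_add"
  assumes "P 0"
    and "\<And>w c. P (Poly_Mapping.single w c)"
    and "\<And>p q. P p \<Longrightarrow> P q \<Longrightarrow> P (p + q)"
  shows "P p"
  using poly_mapping_keys_induct[of p "\<lambda>_. True" P] assms by blast

interpretation fpoly: module "fsmult :: 'a::comm_ring_1 \<Rightarrow> 'a fpoly \<Rightarrow> 'a fpoly"
  by standard (simp_all add: fsmult_def algebra_simps single_add mult_single flip: mult.assoc)

lemma fsmult_single [simp]: "fsmult c (Poly_Mapping.single w d) = Poly_Mapping.single w (c * d)"
  by (simp add: fsmult_def mult_single)

lemma fsmult_power_minus_one: "fsmult ((- 1) ^ m) p = (- 1) ^ m * p"
  for p :: "'a::comm_ring_1 fpoly"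
  by (cases "even m") simp_all

lemma fsmult_mult_left [simp]: "fsmult c p * q = fsmult c (p * q)"
  by (simp add: fsmult_def mult.assoc)

lemma fsmult_mult_right [simp]:
  fixes p :: "'a::comm_ring_1 fpoly"
  shows "p * fsmult c q = fsmult c (p * q)"
proof -
  have "p * Poly_Mapping.single 0 c = Poly_Mapping.single 0 c * p"
    by (induction p rule: poly_mapping_induct) (simp_all add: mult_single algebra_simps)
  then show ?thesis
    by (simp add: fsmult_def flip: mult.assoc)
qed

definition subst_word :: "(var \<Rightarrow> 'a::comm_ring_1 fpoly) \<Rightarrow> word \<Rightarrow> 'a fpoly" where
  "subst_word s w = prod_list (map s (wlist w))"

definition subst_fpoly :: "(var \<Rightarrow> 'a::comm_ring_1 fpoly) \<Rightarrow> 'a fpoly \<Rightarrow> 'a fpoly" where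
  "subst_fpoly s p = (\<Sum>w\<in>Poly_Mapping.keys p. fsmult (Poly_Mapping.lookup p w) (subst_word s w))"

lemma subst_word_add: "subst_word s (v + w) = subst_word s v * subst_word s w"
  by (cases v; cases w) (simp add: subst_word_def)

lemma subst_fpoly_single: "subst_fpoly s (Poly_Mapping.single w c) = fsmult c (subst_word s w)"
  by (simp add: subst_fpoly_def)

lemma subst_fpoly_fvar: "subst_fpoly s (fvar k i) = s (k, i)"
  by (simp add: fvar_def subst_fpoly_single subst_word_def)

interpretation subst_fpoly: module_hom fsmult fsmult "subst_fpoly s"
proof
  show add: "subst_fpoly s (p + q) = subst_fpoly s p + subst_fpoly s q" for p q
    unfolding subst_fpoly_def by (rule setsum_keys_plus_distrib) (simp_all add: fpoly.scale_left_distrib)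
  show "subst_fpoly s (fsmult c p) = fsmult c (subst_fpoly s p)" for c p
  proof (induction p rule: poly_mapping_induct)
    case zero
    show ?case by (simp add: subst_fpoly_def)
  qed (simp_all add: add subst_fpoly_single fpoly.scale_right_distrib)
qed

lemma subst_fpoly_mult: "subst_fpoly s (p * q) = subst_fpoly s p * subst_fpoly s q"
proof (induction p rule: poly_mapping_induct)
  case (single v c)
  show ?case
    by (induction q rule: poly_mapping_induct)
       (simp_all add: mult_single subst_fpoly_single subst_fpoly.add subst_word_add algebra_simps)
qed (simp_all add: algebra_simps subst_fpoly.add)

section \<open>Grading and superinvolution of the free algebra\<close>

lemma ksign_square: "of_int (ksign k) * of_int (ksign k) = (1::'a::ring_1)"
  by (simp add: ksign_def)

lemma ksign_simps [simp]: "ksign YP = 1" "ksign YM = - 1" "ksign k \<noteq> 0"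
  by (simp_all add: ksign_def)

lemma kodd_simps [simp]: "\<not> kodd YP" "\<not> kodd YM" "kodd ZP" "kodd ZM"
  by (simp_all add: kodd_def)

definition fpoly_parity :: "bool \<Rightarrow> 'a::ring_1 fpoly \<Rightarrow> bool" where
  "fpoly_parity b p \<longleftrightarrow> (\<forall>w\<in>Poly_Mapping.keys p. odd (nodd w) = b)"

lemma fpoly_even_iff: "fpoly_even p \<longleftrightarrow> fpoly_parity False p"
  by (simp add: fpoly_even_def fpoly_parity_def)

lemma fpoly_odd_iff: "fpoly_odd p \<longleftrightarrow> fpoly_parity True p"
  by (simp add: fpoly_odd_def fpoly_parity_def)

lemma nodd_add: "nodd (v + w) = nodd v + nodd w"
  by (cases v; cases w) (simp add: nodd_def)

lemma fpoly_parity_one: "fpoly_parity False 1"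
  by (simp add: fpoly_parity_def nodd_def zero_word_def flip: single_one)

lemma fpoly_parity_mult:
  assumes "fpoly_parity a p" "fpoly_parity b q"
  shows "fpoly_parity (a \<noteq> b) (p * q)"
  using assms keys_mult[of p q] unfolding fpoly_parity_def by (fastforce simp: nodd_add)

lemma subspace_fpoly_parity: "fpoly.subspace {p. fpoly_parity b p}"
proof (rule fpoly.subspaceI)
  fix c :: 'a and p :: "'a fpoly"
  assume "p \<in> {p. fpoly_parity b p}"
  then show "fsmult c p \<in> {p. fpoly_parity b p}"
    using fpoly_parity_mult[of False "Poly_Mapping.single 0 c" b p]
    by (simp add: fsmult_def fpoly_parity_def nodd_def zero_word_def)
qed (use keys_add in \<open>fastforce simp: fpoly_parity_def\<close>)+

lemmas fpoly_parity_zero = fpoly.subspace_0[OF subspace_fpoly_parity, simplified]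
  and fpoly_parity_add = fpoly.subspace_add[OF subspace_fpoly_parity, simplified]
  and fpoly_parity_diff = fpoly.subspace_diff[OF subspace_fpoly_parity, simplified]
  and fpoly_parity_fsmult = fpoly.subspace_scale[OF subspace_fpoly_parity, simplified]

lemma fstar_single:
  "fstar (Poly_Mapping.single w c) = Poly_Mapping.single (wrev w) (of_int (wsign w) * c)"
  by (simp add: fstar_def)

interpretation fstar: module_hom fsmult fsmult "fstar :: 'a::comm_ring_1 fpoly \<Rightarrow> 'a fpoly"
proof
  show add: "fstar (p + q) = fstar p + fstar q" for p q :: "'a fpoly"
    unfolding fstar_def by (rule setsum_keys_plus_distrib) (simp_all add: single_add algebra_simps)
  show "fstar (fsmult c p) = fsmult c (fstar p)" for c and p :: "'a fpoly"
  proof (induction p rule: poly_mapping_induct)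
    case zero
    show ?case by (simp add: fstar_def)
  qed (simp_all add: fpoly.scale_right_distrib add fstar_single mult.left_commute)
qed

lemma fstar_one [simp]: "fstar 1 = 1"
proof -
  have "fstar (Poly_Mapping.single 0 1) = Poly_Mapping.single 0 (1::'a)"
    by (simp only: fstar_single) (simp add: wrev_def wsign_def nodd_def zero_word_def binomial_eq_0)
  then show ?thesis by simp
qed

lemma choose_two_add: "(m + n) choose 2 = (m choose 2) + (n choose 2) + m * n" for m n :: nat
proof (induction m)
  case (Suc m)
  have "Suc k choose 2 = (k choose 2) + k" for k
    by (simp add: numeral_2_eq_2)
  with Suc show ?case by simp
qed simp

lemma wsign_add: "wsign (v + w) = (-1) ^ (nodd v * nodd w) * (wsign w * wsign v)"
proof -
  have "prod_list (map (\<lambda>x. ksign (fst x)) (wlist (v + w))) =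
    prod_list (map (\<lambda>x. ksign (fst x)) (wlist v)) * prod_list (map (\<lambda>x. ksign (fst x)) (wlist w))"
    by (cases v; cases w) simp
  then show ?thesis
    by (simp add: wsign_def nodd_add choose_two_add power_add)
qed

lemma wrev_add: "wrev (v + w) = wrev w + wrev v"
  by (cases v; cases w) (simp add: wrev_def)

lemma fstar_mult:
  fixes p q :: "'a::comm_ring_1 fpoly"
  assumes "fpoly_parity a p" "fpoly_parity b q"
  shows "fstar (p * q) = fsmult (if a \<and> b then - 1 else 1) (fstar q * fstar p)"
  using assms(1)[unfolded fpoly_parity_def]
proof (induction p rule: poly_mapping_keys_induct)
  case (single v c)
  show ?case
    using assms(2)[unfolded fpoly_parity_def]
  proof (induction q rule: poly_mapping_keys_induct)
    case (single w d)
    have "(-1::int) ^ (nodd v * nodd w) = (if a \<and> b then -1 else 1)"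
      using single \<open>odd (nodd v) = a\<close> by auto
    then show ?case
      by (auto simp: mult_single fstar_single wsign_add wrev_add mult_ac simp flip: single_uminus)
  qed (auto simp: algebra_simps fstar.add)
qed (auto simp: algebra_simps fstar.add)

definition fpoly_kind :: "vkind \<Rightarrow> 'a::comm_ring_1 fpoly \<Rightarrow> bool" where
  "fpoly_kind k p \<longleftrightarrow> fpoly_parity (kodd k) p \<and> fstar p = fsmult (of_int (ksign k)) p"

lemma fpoly_kind_fvar [simp]: "fpoly_kind k (fvar k i)"
  by (simp add: fpoly_kind_def fpoly_parity_def fvar_def nodd_def kodd_def fstar_single wrev_def
      wsign_def ksign_def binomial_eq_0)

lemma fpoly_kind_one [simp]: "fpoly_kind YP 1"
  by (simp add: fpoly_kind_def fpoly_parity_one kodd_def ksign_def)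

context
  fixes s :: "var \<Rightarrow> 'a::comm_ring_1 fpoly"
  assumes kind: "\<And>x. fpoly_kind (fst x) (s x)"
begin

lemma fpoly_parity_subst_word: "fpoly_parity (odd (nodd w)) (subst_word s w)"
proof (induction "wlist w" arbitrary: w)
  case Nil
  then show ?case by (cases w) (simp add: subst_word_def nodd_def fpoly_parity_one)
next
  case (Cons x xs)
  have "fpoly_parity (kodd (fst x)) (s x)"
    using kind[of x] by (simp add: fpoly_kind_def)
  from fpoly_parity_mult[OF this Cons(1)[of "W xs"]] Cons(2)[symmetric] show ?case
    by (cases w; cases "kodd (fst x)") (simp_all add: subst_word_def nodd_def)
qed

lemma fstar_subst_word: "fstar (subst_word s w) = fsmult (of_int (wsign w)) (subst_word s (wrev w))"
proof (induction "wlist w" arbitrary: w)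
  case Nil
  then show ?case
    by (cases w) (simp add: subst_word_def wsign_def wrev_def nodd_def binomial_eq_0)
next
  case (Cons x xs)
  then have w_eq: "w = W [x] + W xs"
    by (cases w) simp
  have IH: "fstar (subst_word s (W xs)) = fsmult (of_int (wsign (W xs))) (subst_word s (wrev (W xs)))"
    using Cons(1)[of "W xs"] by simp
  have x_kind: "fpoly_parity (kodd (fst x)) (s x)" "fstar (s x) = fsmult (of_int (ksign (fst x))) (s x)"
    using kind[of x] by (simp_all add: fpoly_kind_def)
  have letter: "subst_word s (W [x]) = s x" "wrev (W [x]) = W [x]" "wsign (W [x]) = ksign (fst x)"
    "nodd (W [x]) = of_bool (kodd (fst x))"
    by (simp_all add: subst_word_def wrev_def wsign_def nodd_def binomial_eq_0)
  show ?case
    unfolding w_eq subst_word_add wrev_add wsign_add letter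
      fstar_mult[OF x_kind(1) fpoly_parity_subst_word] IH x_kind(2)
    by (auto simp: mult_ac)
qed

lemma fstar_subst_fpoly: "subst_fpoly s (fstar p) = fstar (subst_fpoly s p)"
  by (induction p rule: poly_mapping_induct)
     (simp_all add: fstar.add subst_fpoly.add fstar_single subst_fpoly_single fstar.scale
        fstar_subst_word mult.commute)

lemma fpoly_parity_subst_fpoly:
  assumes "fpoly_parity b p"
  shows "fpoly_parity b (subst_fpoly s p)"
  using assms unfolding fpoly_parity_def[of b p]
proof (induction p rule: poly_mapping_keys_induct)
  case (single w c)
  then show ?case
    using fpoly_parity_subst_word[of w] by (simp add: subst_fpoly_single fpoly_parity_fsmult)
qed (simp_all add: subst_fpoly.add fpoly_parity_add fpoly_parity_zero)

lemma star_graded_endo_subst_fpoly: "star_graded_endo (subst_fpoly s)"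
  unfolding star_graded_endo_def fpoly_even_iff fpoly_odd_iff
  by (simp add: subst_fpoly.add subst_fpoly.scale subst_fpoly_mult fstar_subst_fpoly
      fpoly_parity_subst_fpoly)

end

section \<open>Evaluation in the matrix superalgebra\<close>

definition matrix_scale :: "'a::comm_ring_1 \<Rightarrow> 'a^'n^'m \<Rightarrow> 'a^'n^'m" where
  "matrix_scale c A = (\<chi> i j. c * A $ i $ j)"

lemma matrix_scale_nth [simp]: "matrix_scale c A $ i $ j = c * A $ i $ j"
  by (simp add: matrix_scale_def)

interpretation matrix: module "matrix_scale :: 'a::comm_ring_1 \<Rightarrow> 'a^'n^'m \<Rightarrow> 'a^'n^'m"
  by standard (simp_all add: vec_eq_iff algebra_simps)

lemma matrix_scale_mult_left [simp]: "matrix_scale c A ** B = matrix_scale c (A ** B)"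
  by (simp add: vec_eq_iff matrix_matrix_mult_def sum_distrib_left mult_ac)

lemma matrix_scale_mult_right [simp]: "A ** matrix_scale c B = matrix_scale c (A ** B)"
  by (simp add: vec_eq_iff matrix_matrix_mult_def sum_distrib_left mult_ac)

lemma matrix3_eq_iff:
  "A = B \<longleftrightarrow> A$1$1 = B$1$1 \<and> A$1$2 = B$1$2 \<and> A$1$3 = B$1$3 \<and> A$2$1 = B$2$1 \<and> A$2$2 = B$2$2
     \<and> A$2$3 = B$2$3 \<and> A$3$1 = B$3$1 \<and> A$3$2 = B$3$2 \<and> A$3$3 = B$3$3" for A B :: "'a^3^3"
  by (auto simp: vec_eq_iff forall_3)

definition mat_kind :: "vkind \<Rightarrow> 'a::field^3^3 \<Rightarrow> bool" where
  "mat_kind k A \<longleftrightarrow> (if kodd k then M12_odd A else M12_even A) \<and>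
     M12_star A = matrix_scale (of_int (ksign k)) A"

lemma M12_admissible_iff: "M12_admissible \<sigma> \<longleftrightarrow> (\<forall>x. mat_kind (fst x) (\<sigma> x))"
proof -
  have "(\<forall>x. mat_kind (fst x) (\<sigma> x)) \<longleftrightarrow> (\<forall>k. \<forall>i. mat_kind k (\<sigma> (k, i)))"
    by simp
  also have "\<dots> \<longleftrightarrow> (\<forall>i. mat_kind YP (\<sigma> (YP, i)) \<and> mat_kind YM (\<sigma> (YM, i)) \<and>
     mat_kind ZP (\<sigma> (ZP, i)) \<and> mat_kind ZM (\<sigma> (ZM, i)))"
    by (metis vkind.exhaust)
  finally show ?thesis
    by (simp add: M12_admissible_def mat_kind_def kodd_def ksign_def)
qed

lemma M12_star_add: "M12_star (A + B) = M12_star A + M12_star B"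
  by (simp add: M12_star_def matrix3_eq_iff)

lemma M12_star_matrix_scale: "M12_star (matrix_scale c A) = matrix_scale c (M12_star A)"
  by (simp add: M12_star_def matrix3_eq_iff)

lemma M12_star_zero: "M12_star 0 = 0"
  by (simp add: M12_star_def matrix3_eq_iff)

lemma subspace_mat_kind: "matrix.subspace {A. mat_kind k A}"
  by (rule matrix.subspaceI)
     (simp_all add: mat_kind_def M12_odd_def M12_even_def M12_star_add M12_star_matrix_scale
        M12_star_zero matrix.scale_right_distrib mult.commute split: if_splits)

lemmas mat_kind_zero = matrix.subspace_0[OF subspace_mat_kind, simplified]
  and mat_kind_sum = matrix.subspace_sum[OF subspace_mat_kind, simplified]

lemma eval_fpoly_single:
  "eval_fpoly \<sigma> (Poly_Mapping.single w c) = matrix_scale c (eval_word \<sigma> w)"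
  by (simp add: eval_fpoly_def matrix_scale_def vec_eq_iff)

interpretation eval_fpoly: module_hom fsmult matrix_scale "eval_fpoly \<sigma>"
proof
  show add: "eval_fpoly \<sigma> (p + q) = eval_fpoly \<sigma> p + eval_fpoly \<sigma> q" for p q
    unfolding eval_fpoly_def by (rule setsum_keys_plus_distrib) (simp_all add: vec_eq_iff algebra_simps)
  show "eval_fpoly \<sigma> (fsmult c p) = matrix_scale c (eval_fpoly \<sigma> p)" for c p
  proof (induction p rule: poly_mapping_induct)
    case zero
    show ?case by (simp add: eval_fpoly_def)
  qed (simp_all add: fpoly.scale_right_distrib matrix.scale_right_distrib add eval_fpoly_single)
qed

lemma eval_word_add: "eval_word \<sigma> (v + w) = eval_word \<sigma> v ** eval_word \<sigma> w"
proof -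
  have "eval_word \<sigma> (W xs + W ys) = eval_word \<sigma> (W xs) ** eval_word \<sigma> (W ys)" for xs ys
    by (induction xs) (simp_all add: eval_word_def matrix_mul_assoc)
  then show ?thesis by (cases v; cases w) simp
qed

lemma eval_fpoly_mult: "eval_fpoly \<sigma> (p * q) = eval_fpoly \<sigma> p ** eval_fpoly \<sigma> q"
proof (induction p rule: poly_mapping_induct)
  case (single v c)
  show ?case
    by (induction q rule: poly_mapping_induct)
       (simp_all add: mult_single eval_fpoly_single eval_word_add eval_fpoly.add
          matrix_add_ldistrib algebra_simps)
next
  case (add p q)
  then show ?case
    by (simp add: eval_fpoly.add algebra_simps vec_eq_iff matrix_matrix_mult_def sum.distrib)
qed simp

lemma eval_fpoly_fvar: "eval_fpoly \<sigma> (fvar k i) = \<sigma> (k, i)"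
  by (simp add: fvar_def eval_fpoly_single eval_word_def)

lemma eval_fpoly_one: "eval_fpoly \<sigma> 1 = mat 1"
proof -
  have "eval_word \<sigma> 0 = mat 1"
    by (simp add: eval_word_def zero_word_def)
  then show ?thesis
    using eval_fpoly_single[of \<sigma> 0 1] by simp
qed

lemma eval_subst_fpoly: "eval_fpoly \<sigma> (subst_fpoly s p) = eval_fpoly (\<lambda>x. eval_fpoly \<sigma> (s x)) p"
proof (induction p rule: poly_mapping_induct)
  case (single w c)
  have "eval_fpoly \<sigma> (prod_list (map s xs)) = eval_word (\<lambda>x. eval_fpoly \<sigma> (s x)) (W xs)" for xs
    by (induction xs) (simp_all add: eval_word_def eval_fpoly_mult eval_fpoly_one)
  from this[of "wlist w"] show ?case
    by (cases w) (simp add: subst_fpoly_single eval_fpoly.scale eval_fpoly_single subst_word_def)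
qed (simp_all add: subst_fpoly.add eval_fpoly.add)

lemma subspace_M12_star_identity: "fpoly.subspace {f. is_M12_star_identity f}"
  by (rule fpoly.subspaceI)
     (simp_all add: is_M12_star_identity_def eval_fpoly.add eval_fpoly.scale)

lemma M12_star_identity_mult_right:
  "is_M12_star_identity f \<Longrightarrow> is_M12_star_identity (f * g)"
  by (simp add: is_M12_star_identity_def eval_fpoly_mult)

lemma M12_star_identity_subst:
  assumes "is_M12_star_identity f"
    and "\<And>\<sigma> x. M12_admissible \<sigma> \<Longrightarrow> mat_kind (fst x) (eval_fpoly \<sigma> (s x))"
  shows "is_M12_star_identity (subst_fpoly s f)"
  unfolding is_M12_star_identity_def eval_subst_fpoly
proof (intro allI impI)
  fix \<sigma> :: "var \<Rightarrow> 'a^3^3"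
  assume "M12_admissible \<sigma>"
  with assms(2) have "M12_admissible (\<lambda>x. eval_fpoly \<sigma> (s x))"
    by (simp add: M12_admissible_iff[of "\<lambda>x. eval_fpoly \<sigma> (s x)"])
  with assms(1) show "eval_fpoly (\<lambda>x. eval_fpoly \<sigma> (s x)) f = 0"
    by (simp add: is_M12_star_identity_def)
qed

section \<open>Polarization\<close>

lemma sum_lists_Suc:
  fixes h :: "'b list \<Rightarrow> 'c::comm_monoid_add"
  shows "(\<Sum>xs | set xs \<subseteq> V \<and> length xs = Suc n. h xs)
    = (\<Sum>x\<in>V. \<Sum>xs | set xs \<subseteq> V \<and> length xs = n. h (x # xs))"
proof -
  have "(\<Sum>xs | set xs \<subseteq> V \<and> length xs = Suc n. h xs)
      = (\<Sum>(x, xs)\<in>V \<times> {xs. set xs \<subseteq> V \<and> length xs = n}. h (x # xs))"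
    by (rule sum.reindex_bij_witness[where i = "\<lambda>(x, xs). x # xs" and j = "\<lambda>xs. (hd xs, tl xs)"])
       (auto simp: length_Suc_conv)
  then show ?thesis
    by (simp add: sum.cartesian_product)
qed

lemma prod_list_sum_distrib:
  fixes g :: "'i \<Rightarrow> 'b \<Rightarrow> 'c::semiring_1"
  shows "(\<Prod>y\<leftarrow>ys. \<Sum>i\<in>S. g i y)
    = (\<Sum>is | set is \<subseteq> S \<and> length is = length ys. prod_list (map2 g is ys))"
proof (induction ys)
  case Nil
  have "{is. set is \<subseteq> S \<and> is = []} = {[]}"
    by auto
  then show ?case by simp
next
  case (Cons y ys)
  then show ?case
    by (simp add: sum_lists_Suc sum_product)
qed

lemma sum_supersets_alternating:
  assumes "finite I" "T \<subseteq> I"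
  shows "(\<Sum>S\<in>Pow I. of_bool (T \<subseteq> S) * (- 1) ^ card (I - S)) = (of_bool (T = I) :: 'c::comm_ring_1)"
proof -
  let ?f = "\<lambda>i. if i \<in> T then 0 else - 1 :: 'c"
  have "(\<Prod>i\<in>I - S. ?f i) = of_bool (T \<subseteq> S) * (- 1) ^ card (I - S)" for S
  proof (cases "T \<subseteq> S")
    case True
    then have "(\<Prod>i\<in>I - S. ?f i) = (\<Prod>i\<in>I - S. - 1)"
      by (intro prod.cong) auto
    with True show ?thesis by simp
  next
    case False
    then have "\<exists>i\<in>I - S. ?f i = 0"
      using assms(2) by auto
    with False assms(1) show ?thesis
      by (simp add: prod_zero)
  qed
  then have "(\<Sum>S\<in>Pow I. of_bool (T \<subseteq> S) * (- 1) ^ card (I - S))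
      = (\<Sum>S\<in>Pow I. (\<Prod>i\<in>S. 1) * (\<Prod>i\<in>I - S. ?f i))"
    by simp
  also have "\<dots> = (\<Prod>i\<in>I. 1 + ?f i)"
    using assms(1) by (rule prod_add[symmetric])
  also have "\<dots> = (\<Prod>i\<in>I. of_bool (i \<in> T))"
    by (intro prod.cong) auto
  also have "\<dots> = of_bool (I \<subseteq> T)"
    using assms(1) by (induction I) auto
  also have "\<dots> = of_bool (T = I)"
    using assms(2) by (auto intro: arg_cong[where f = of_bool])
  finally show ?thesis .
qed

lemma prod_list_polarization:
  fixes g :: "'i \<Rightarrow> 'b \<Rightarrow> 'c::ring_1"
  assumes "finite I"
  shows "(\<Sum>S\<in>Pow I. of_int ((- 1) ^ card (I - S)) * (\<Prod>y\<leftarrow>ys. \<Sum>i\<in>S. g i y))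
    = (\<Sum>is | set is = I \<and> length is = length ys. prod_list (map2 g is ys))"
proof -
  let ?L = "{is. set is \<subseteq> I \<and> length is = length ys}"
  let ?sgn = "\<lambda>S. (- 1) ^ card (I - S) :: int"
  let ?prod = "\<lambda>is. prod_list (map2 g is ys)"
  have finite_L: "finite ?L"
    using assms by (rule finite_lists_length_eq)
  have "(\<Prod>y\<leftarrow>ys. \<Sum>i\<in>S. g i y) = (\<Sum>is\<in>?L. of_bool (set is \<subseteq> S) * ?prod is)" if "S \<in> Pow I" for S
    unfolding prod_list_sum_distrib using that by (intro sum.mono_neutral_cong_left finite_L) auto
  then have "(\<Sum>S\<in>Pow I. of_int (?sgn S) * (\<Prod>y\<leftarrow>ys. \<Sum>i\<in>S. g i y))
      = (\<Sum>S\<in>Pow I. \<Sum>is\<in>?L. of_int (of_bool (set is \<subseteq> S) * ?sgn S) * ?prod is)"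
    by (intro sum.cong) (auto simp: sum_distrib_left intro!: sum.cong)
  also have "\<dots> = (\<Sum>is\<in>?L. of_int (\<Sum>S\<in>Pow I. of_bool (set is \<subseteq> S) * ?sgn S) * ?prod is)"
    unfolding of_int_sum sum_distrib_right by (rule sum.swap)
  also have "\<dots> = (\<Sum>is\<in>?L. of_bool (set is = I) * ?prod is)"
    using assms by (intro sum.cong refl) (subst sum_supersets_alternating, auto)
  also have "\<dots> = (\<Sum>is | set is = I \<and> length is = length ys. ?prod is)"
    by (intro sum.mono_neutral_cong_right finite_L) auto
  finally show ?thesis .
qed

lemma surjective_lists_eq_permutations:
  assumes "m \<le> card I"
  shows "{is. set is = I \<and> length is = m} = {\<pi> \<in> permutations_of_set I. length \<pi> = m}"
proof -
  have "distinct is" if "set is = I" "length is = m" for "is"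
    using that assms card_length[of "is"] by (intro card_distinct) simp
  then show ?thesis
    unfolding permutations_of_set_def by blast
qed

text \<open>The letter in position \<open>i\<close> has index \<open>i\<close>, so the letters are distinct even if kinds repeat.\<close>

definition multilinear :: "(nat list \<Rightarrow> 'a) \<Rightarrow> vkind list \<Rightarrow> 'a::comm_monoid_add fpoly" where
  "multilinear c ks = (\<Sum>\<pi>\<in>permutations_of_set {..<length ks}.
     Poly_Mapping.single (W (map (\<lambda>i. (ks ! i, i)) \<pi>)) (c \<pi>))"

definition polarization :: "'a::comm_monoid_add fpoly \<Rightarrow> var list \<Rightarrow> 'a fpoly" where
  "polarization f xs = multilinear (\<lambda>\<pi>. Poly_Mapping.lookup f (W (map ((!) xs) \<pi>))) (map fst xs)"

lemma polarization_altdef: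
  "polarization f xs = (\<Sum>\<pi>\<in>permutations_of_set {..<length xs}.
     Poly_Mapping.single (W (map (\<lambda>i. (fst (xs ! i), i)) \<pi>))
       (Poly_Mapping.lookup f (W (map ((!) xs) \<pi>))))"
proof -
  have "map (\<lambda>i. (map fst xs ! i, i)) \<pi> = map (\<lambda>i. (fst (xs ! i), i)) \<pi>"
    if "\<pi> \<in> permutations_of_set {..<length xs}" for \<pi>
    using permutations_of_setD(1)[OF that] by simp
  then show ?thesis
    unfolding polarization_def multilinear_def length_map by (intro sum.cong refl) (simp only:)
qed

definition letter_sum :: "var list \<Rightarrow> nat set \<Rightarrow> var \<Rightarrow> 'a::ring_1 fpoly" where
  "letter_sum xs S x = (\<Sum>i\<in>S. if xs ! i = x then fvar (fst x) i else 0)"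

lemma prod_list_matching_letters:
  assumes "length is = length ys"
  shows "prod_list (map2 (\<lambda>i y. if xs ! i = y then fvar (fst y) i else 0) is ys)
    = (if map ((!) xs) is = ys then Poly_Mapping.single (W (map (\<lambda>i. (fst (xs ! i), i)) is)) 1 else 0)"
  using assms
proof (induction rule: list_induct2)
  case Nil
  show ?case by (simp flip: zero_word_def)
qed (simp add: fvar_def mult_single)

lemma sum_subst_word_letter_sum:
  assumes "wdeg w \<le> length xs"
  shows "(\<Sum>S\<in>Pow {..<length xs}.
      fsmult ((- 1) ^ card ({..<length xs} - S)) (subst_word (letter_sum xs S) w))
    = (\<Sum>\<pi>\<in>permutations_of_set {..<length xs}. if map ((!) xs) \<pi> = wlist w
         then Poly_Mapping.single (W (map (\<lambda>i. (fst (xs ! i), i)) \<pi>)) 1 else 0)"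
proof -
  let ?I = "{..<length xs}" and ?m = "length (wlist w)"
  let ?term = "\<lambda>\<pi>. if map ((!) xs) \<pi> = wlist w
    then Poly_Mapping.single (W (map (\<lambda>i. (fst (xs ! i), i)) \<pi>)) 1 else 0"
  have "(\<Sum>S\<in>Pow ?I. fsmult ((- 1) ^ card (?I - S)) (subst_word (letter_sum xs S) w))
      = (\<Sum>S\<in>Pow ?I. of_int ((- 1) ^ card (?I - S)) *
          (\<Prod>y\<leftarrow>wlist w. \<Sum>i\<in>S. if xs ! i = y then fvar (fst y) i else 0))"
    unfolding fsmult_power_minus_one subst_word_def letter_sum_def[abs_def]
    by (simp only: of_int_power of_int_minus of_int_1)
  also have "\<dots> = (\<Sum>is | set is = ?I \<and> length is = ?m. ?term is)"
    by (subst prod_list_polarization[OF finite_lessThan], rule sum.cong[OF refl])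
       (simp add: prod_list_matching_letters)
  also have "\<dots> = (\<Sum>\<pi>\<in>{\<pi> \<in> permutations_of_set ?I. length \<pi> = ?m}. ?term \<pi>)"
    using assms by (subst surjective_lists_eq_permutations) (simp_all add: wdeg_def)
  also have "\<dots> = (\<Sum>\<pi>\<in>permutations_of_set ?I. ?term \<pi>)"
  proof (rule sum.mono_neutral_left)
    have "map ((!) xs) \<pi> \<noteq> wlist w" if "length \<pi> \<noteq> ?m" for \<pi>
      using that by (metis length_map)
    then show "\<forall>\<pi>\<in>permutations_of_set ?I - {\<pi> \<in> permutations_of_set ?I. length \<pi> = ?m}. ?term \<pi> = 0"
      by simp
  qed auto
  finally show ?thesis .
qed

lemma polarization_eq_sum_subst:
  assumes "fdeg_le f (length xs)"
  shows "polarization f xs = (\<Sum>S\<in>Pow {..<length xs}.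
      fsmult ((- 1) ^ card ({..<length xs} - S)) (subst_fpoly (letter_sum xs S) f))"
  using assms unfolding fdeg_le_def
proof (induction f rule: poly_mapping_keys_induct)
  case (single w c)
  have "polarization (Poly_Mapping.single w c) xs
      = fsmult c (\<Sum>\<pi>\<in>permutations_of_set {..<length xs}. if map ((!) xs) \<pi> = wlist w
          then Poly_Mapping.single (W (map (\<lambda>i. (fst (xs ! i), i)) \<pi>)) 1 else 0)"
    unfolding polarization_altdef fpoly.scale_sum_right
    by (cases w) (auto intro!: sum.cong simp: lookup_single when_def)
  also have "\<dots> = fsmult c (\<Sum>S\<in>Pow {..<length xs}.
      fsmult ((- 1) ^ card ({..<length xs} - S)) (subst_word (letter_sum xs S) w))"
    unfolding sum_subst_word_letter_sum[OF single] ..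
  finally show ?case
    by (simp add: fpoly.scale_sum_right subst_fpoly_single mult.commute)
qed (simp_all add: polarization_altdef lookup_add single_add sum.distrib subst_fpoly.add
      fpoly.scale_right_distrib)

lemma M12_star_identity_polarization:
  assumes "is_M12_star_identity f" "fdeg_le f (length xs)"
  shows "is_M12_star_identity (polarization f xs)"
proof -
  have "is_M12_star_identity (subst_fpoly (letter_sum xs S) f)" for S
  proof (rule M12_star_identity_subst[OF assms(1)])
    fix \<sigma> :: "var \<Rightarrow> 'a^3^3" and x
    assume "M12_admissible \<sigma>"
    then have "mat_kind (fst x) (eval_fpoly \<sigma> (if xs ! i = x then fvar (fst x) i else 0))" for i
      by (simp add: M12_admissible_iff eval_fpoly_fvar mat_kind_zero)
    then show "mat_kind (fst x) (eval_fpoly \<sigma> (letter_sum xs S x))"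
      by (simp add: letter_sum_def eval_fpoly.sum mat_kind_sum)
  qed
  then show ?thesis
    unfolding polarization_eq_sum_subst[OF assms(2)]
    by (intro fpoly.subspace_sum[OF subspace_M12_star_identity, simplified]
        fpoly.subspace_scale[OF subspace_M12_star_identity, simplified])
qed

section \<open>Reduction to multilinear identities\<close>

definition letters :: "'a::zero fpoly \<Rightarrow> var set" where
  "letters f = (\<Union>w\<in>Poly_Mapping.keys f. set (wlist w))"

definition hom_component :: "nat \<Rightarrow> 'a::comm_monoid_add fpoly \<Rightarrow> 'a fpoly" where
  "hom_component n f = (\<Sum>xs | set xs \<subseteq> letters f \<and> length xs = n.
     Poly_Mapping.single (W xs) (Poly_Mapping.lookup f (W xs)))"

lemma finite_words_over_letters: "finite {xs. set xs \<subseteq> letters f \<and> length xs = n}"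
  by (rule finite_lists_length_eq) (simp add: letters_def)

lemma lookup_hom_component:
  "Poly_Mapping.lookup (hom_component n f) w = (if wdeg w = n then Poly_Mapping.lookup f w else 0)"
proof (cases w)
  case (W ys)
  have "Poly_Mapping.lookup (hom_component n f) w
      = (\<Sum>xs | set xs \<subseteq> letters f \<and> length xs = n. if xs = ys then Poly_Mapping.lookup f w else 0)"
    unfolding hom_component_def lookup_sum
    by (intro sum.cong refl) (simp add: W lookup_single when_def)
  also have "\<dots> = (if set ys \<subseteq> letters f \<and> length ys = n then Poly_Mapping.lookup f w else 0)"
    by (simp add: sum.delta[OF finite_words_over_letters])
  finally show ?thesis
    by (auto simp: W wdeg_def letters_def in_keys_iff)
qed

lemma sum_lists_permute:
  assumes "finite V" and \<pi>: "\<pi> \<in> permutations_of_set {..<n}"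
  shows "(\<Sum>xs | set xs \<subseteq> V \<and> length xs = n. h (map ((!) xs) \<pi>))
    = (\<Sum>xs | set xs \<subseteq> V \<and> length xs = n. h xs)"
proof (rule sum.reindex_bij_betw)
  let ?L = "{xs. set xs \<subseteq> V \<and> length xs = n}"
  have set_\<pi>: "set \<pi> = {..<n}" and len_\<pi>: "length \<pi> = n"
    using permutations_of_setD[OF \<pi>] distinct_card[of \<pi>] by simp_all
  have inj: "inj_on (\<lambda>xs. map ((!) xs) \<pi>) ?L"
  proof (rule inj_onI)
    fix xs ys assume "xs \<in> ?L" "ys \<in> ?L" "map ((!) xs) \<pi> = map ((!) ys) \<pi>"
    then show "xs = ys"
      by (intro nth_equalityI) (auto simp: set_\<pi>)
  qed
  moreover have "(\<lambda>xs. map ((!) xs) \<pi>) ` ?L \<subseteq> ?L"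
    by (simp add: set_\<pi> len_\<pi> image_subset_iff subsetD[OF _ nth_mem])
  ultimately show "bij_betw (\<lambda>xs. map ((!) xs) \<pi>) ?L ?L"
    by (simp add: bij_betw_def endo_inj_surj finite_lists_length_eq[OF assms(1)])
qed

lemma subst_multilinear:
  "subst_fpoly s (multilinear c ks)
    = (\<Sum>\<pi>\<in>permutations_of_set {..<length ks}. fsmult (c \<pi>) (\<Prod>i\<leftarrow>\<pi>. s (ks ! i, i)))"
  by (simp add: multilinear_def subst_fpoly.sum subst_fpoly_single subst_word_def comp_def)

lemma permutations_of_lessThan_Suc_ending_in:
  "{\<pi> \<in> permutations_of_set {..<Suc n}. last \<pi> = n} = (\<lambda>\<rho>. \<rho> @ [n]) ` permutations_of_set {..<n}"
proof (intro equalityI subsetI)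
  fix \<pi> assume "\<pi> \<in> {\<pi> \<in> permutations_of_set {..<Suc n}. last \<pi> = n}"
  then have \<pi>: "set \<pi> = {..<Suc n}" "distinct \<pi>" "last \<pi> = n"
    by (simp_all add: permutations_of_set_def)
  then have "n \<in> set \<pi>"
    by simp
  then obtain \<rho> where \<rho>: "\<pi> = \<rho> @ [n]"
    using \<pi>(3) by (metis append_butlast_last_id empty_iff list.set(1))
  have "set \<rho> = set \<pi> - {n}"
    using \<pi>(2) \<rho> by auto
  also have "\<dots> = {..<n}"
    unfolding \<pi>(1) by auto
  finally have "\<rho> \<in> permutations_of_set {..<n}"
    using \<pi>(2) \<rho> by (simp add: permutations_of_set_def)
  with \<rho> show "\<pi> \<in> (\<lambda>\<rho>. \<rho> @ [n]) ` permutations_of_set {..<n}"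
    by blast
next
  fix \<pi> assume "\<pi> \<in> (\<lambda>\<rho>. \<rho> @ [n]) ` permutations_of_set {..<n}"
  then obtain \<rho> where "\<pi> = \<rho> @ [n]" "set \<rho> = {..<n}" "distinct \<rho>"
    by (auto dest: permutations_of_setD)
  then show "\<pi> \<in> {\<pi> \<in> permutations_of_set {..<Suc n}. last \<pi> = n}"
    by (simp add: permutations_of_set_def lessThan_Suc)
qed

lemma multilinear_append_YP:
  "multilinear (\<lambda>\<pi>. if last \<pi> = length ks then c (butlast \<pi>) else 0) (ks @ [YP])
    = multilinear c ks * fvar YP (length ks)"
proof -
  let ?n = "length ks"
  let ?word = "\<lambda>ks \<pi>. W (map (\<lambda>i. (ks ! i, i)) \<pi>)"
  have append: "Poly_Mapping.single (?word (ks @ [YP]) (\<rho> @ [?n])) (c \<rho>)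
      = Poly_Mapping.single (?word ks \<rho>) (c \<rho>) * fvar YP ?n"
    if "\<rho> \<in> permutations_of_set {..<?n}" for \<rho>
  proof -
    have "map (\<lambda>i. ((ks @ [YP]) ! i, i)) \<rho> = map (\<lambda>i. (ks ! i, i)) \<rho>"
      using permutations_of_setD(1)[OF that] by (simp add: nth_append)
    then show ?thesis
      by (simp add: fvar_def mult_single del: map_eq_conv)
  qed
  have "multilinear (\<lambda>\<pi>. if last \<pi> = ?n then c (butlast \<pi>) else 0) (ks @ [YP])
      = (\<Sum>\<pi>\<in>permutations_of_set {..<Suc ?n}. if last \<pi> = ?n
          then Poly_Mapping.single (?word (ks @ [YP]) \<pi>) (c (butlast \<pi>)) else 0)"
    unfolding multilinear_def by (intro sum.cong) simp_all
  also have "\<dots> = (\<Sum>\<rho>\<in>permutations_of_set {..<?n}.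
      Poly_Mapping.single (?word (ks @ [YP]) (\<rho> @ [?n])) (c \<rho>))"
    by (simp add: permutations_of_lessThan_Suc_ending_in sum.reindex inj_on_def flip: sum.inter_filter)
  also have "\<dots> = (\<Sum>\<rho>\<in>permutations_of_set {..<?n}.
      Poly_Mapping.single (?word ks \<rho>) (c \<rho>) * fvar YP ?n)"
    by (intro sum.cong refl append)
  finally show ?thesis
    by (simp add: multilinear_def sum_distrib_right)
qed

locale T2star_ideal =
  fixes J :: "'a::field_char_0 fpoly set"
  assumes ideal: "is_T2star_ideal J"
begin

lemma subspace: "fpoly.subspace J"
  using ideal by (auto simp: is_T2star_ideal_def fpoly.subspace_def)

lemma mult_left_mem: "p \<in> J \<Longrightarrow> a * p \<in> J"
  using ideal by (simp add: is_T2star_ideal_def)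

lemma mult_right_mem: "p \<in> J \<Longrightarrow> p * a \<in> J"
  using ideal by (simp add: is_T2star_ideal_def)

lemmas mem_intros =
  fpoly.subspace_add[OF subspace] fpoly.subspace_scale[OF subspace] mult_left_mem mult_right_mem

lemma subst_mem:
  assumes "p \<in> J" "\<And>x. fpoly_kind (fst x) (s x)"
  shows "subst_fpoly s p \<in> J"
  using ideal star_graded_endo_subst_fpoly[OF assms(2)] assms(1) by (auto simp: is_T2star_ideal_def)

definition contains_multilinear_identities :: "nat \<Rightarrow> bool" where
  "contains_multilinear_identities n \<longleftrightarrow>
     (\<forall>c ks. length ks = n \<longrightarrow> is_M12_star_identity (multilinear c ks) \<longrightarrow> multilinear c ks \<in> J)"

lemma contains_multilinear_identities_of_Suc:
  assumes "contains_multilinear_identities (Suc n)"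
  shows "contains_multilinear_identities n"
  unfolding contains_multilinear_identities_def
proof (intro allI impI)
  fix c :: "nat list \<Rightarrow> 'a" and ks
  assume length_ks: "length ks = n" and ident: "is_M12_star_identity (multilinear c ks)"
  let ?n = "length ks"
  define s where "s = (case_prod fvar)((YP, ?n) := 1 :: 'a fpoly)"
  have "multilinear c ks * fvar YP ?n \<in> J"
    unfolding multilinear_append_YP[symmetric]
  proof (rule assms[unfolded contains_multilinear_identities_def, rule_format])
    show "length (ks @ [YP]) = Suc n"
      by (simp add: length_ks)
  qed (simp add: multilinear_append_YP M12_star_identity_mult_right[OF ident])
  then have "subst_fpoly s (multilinear c ks * fvar YP ?n) \<in> J"
    by (rule subst_mem) (auto simp: s_def)
  moreover have "subst_fpoly s (multilinear c ks) = multilinear c ks"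
  proof -
    have "(\<Prod>i\<leftarrow>\<pi>. s (ks ! i, i)) = Poly_Mapping.single (W (map (\<lambda>i. (ks ! i, i)) \<pi>)) 1"
      if "set \<pi> \<subseteq> {..<?n}" for \<pi>
      using that
      by (induction \<pi>) (simp_all add: s_def fvar_def mult_single flip: zero_word_def)
    then have "subst_fpoly s (multilinear c ks) = (\<Sum>\<pi>\<in>permutations_of_set {..<?n}.
        Poly_Mapping.single (W (map (\<lambda>i. (ks ! i, i)) \<pi>)) (c \<pi>))"
      unfolding subst_multilinear by (intro sum.cong refl) (simp add: permutations_of_set_def)
    then show ?thesis
      by (simp only: multilinear_def)
  qed
  ultimately show "multilinear c ks \<in> J"
    by (simp add: subst_fpoly_mult subst_fpoly_fvar s_def)
qed

lemma sum_permuted_words_mem: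
  assumes multilinear: "contains_multilinear_identities (length xs)"
    and f: "is_M12_star_identity f" "fdeg_le f (length xs)"
  shows "(\<Sum>\<pi>\<in>permutations_of_set {..<length xs}.
      Poly_Mapping.single (W (map ((!) xs) \<pi>)) (Poly_Mapping.lookup f (W (map ((!) xs) \<pi>))))
    \<in> J \<inter> {f. is_M12_star_identity f}"
proof -
  define s :: "var \<Rightarrow> 'a fpoly" where
    "s x = (if snd x < length xs \<and> fst (xs ! snd x) = fst x
      then case_prod fvar (xs ! snd x) else case_prod fvar x)" for x
  have kind: "fpoly_kind (fst x) (s x)" for x
    by (auto simp: s_def split: prod.splits)
  have eval_kind: "mat_kind (fst x) (eval_fpoly \<sigma> (s x))" if "M12_admissible \<sigma>" for \<sigma> x
    using that by (auto simp: s_def M12_admissible_iff eval_fpoly_fvar split: prod.splits)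
  have ident: "is_M12_star_identity (polarization f xs)"
    using f by (rule M12_star_identity_polarization)
  then have "polarization f xs \<in> J"
    using multilinear by (simp add: contains_multilinear_identities_def polarization_def)
  then have "subst_fpoly s (polarization f xs) \<in> J \<inter> {f. is_M12_star_identity f}"
    using kind eval_kind ident by (simp add: subst_mem M12_star_identity_subst)
  moreover have "subst_fpoly s (polarization f xs) = (\<Sum>\<pi>\<in>permutations_of_set {..<length xs}.
      Poly_Mapping.single (W (map ((!) xs) \<pi>)) (Poly_Mapping.lookup f (W (map ((!) xs) \<pi>))))"
  proof -
    have "(\<Prod>i\<leftarrow>\<pi>. s (map fst xs ! i, i)) = Poly_Mapping.single (W (map ((!) xs) \<pi>)) 1"
      if "set \<pi> \<subseteq> {..<length xs}" for \<pi>
      using that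
      by (induction \<pi>) (auto simp: s_def fvar_def mult_single split: prod.splits simp flip: zero_word_def)
    then show ?thesis
      unfolding polarization_def subst_multilinear
      by (intro sum.cong) (auto simp: permutations_of_set_def)
  qed
  ultimately show ?thesis by simp
qed

lemma hom_component_mem:
  assumes "contains_multilinear_identities n"
    and "is_M12_star_identity f" "fdeg_le f n"
  shows "hom_component n f \<in> J \<inter> {f. is_M12_star_identity f}"
proof -
  let ?K = "J \<inter> {f. is_M12_star_identity f}"
  let ?L = "{xs. set xs \<subseteq> letters f \<and> length xs = n}"
  let ?P = "permutations_of_set {..<n}"
  let ?term = "\<lambda>xs. Poly_Mapping.single (W xs) (Poly_Mapping.lookup f (W xs))"
  have subspace_K: "fpoly.subspace ?K"
    by (intro fpoly.subspace_inter subspace subspace_M12_star_identity)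
  have "(\<Sum>\<pi>\<in>?P. ?term (map ((!) xs) \<pi>)) \<in> ?K" if "xs \<in> ?L" for xs
    using sum_permuted_words_mem[of xs f] that assms by simp
  then have "(\<Sum>xs\<in>?L. \<Sum>\<pi>\<in>?P. ?term (map ((!) xs) \<pi>)) \<in> ?K"
    by (rule fpoly.subspace_sum[OF subspace_K])
  also have "(\<Sum>xs\<in>?L. \<Sum>\<pi>\<in>?P. ?term (map ((!) xs) \<pi>)) = (\<Sum>\<pi>\<in>?P. hom_component n f)"
    unfolding hom_component_def
    by (subst sum.swap, intro sum.cong refl sum_lists_permute) (simp_all add: letters_def)
  also have "\<dots> = fsmult (fact n) (hom_component n f)"
    by (simp only: fpoly.sum_constant_scale) simp
  finally have "fsmult (1 / fact n) (fsmult (fact n) (hom_component n f)) \<in> ?K"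
    by (rule fpoly.subspace_scale[OF subspace_K])
  then show ?thesis by simp
qed

theorem identity_mem_of_multilinear:
  assumes "contains_multilinear_identities n"
    and "is_M12_star_identity f" "fdeg_le f n"
  shows "f \<in> J"
  using assms
proof (induction n arbitrary: f)
  case 0
  have "f = hom_component 0 f"
    using 0(3) by (intro poly_mapping_eqI) (force simp: lookup_hom_component fdeg_le_def in_keys_iff)
  with hom_component_mem[OF 0] show ?case by simp
next
  case (Suc n)
  note top = hom_component_mem[OF Suc.prems]
  have "f - hom_component (Suc n) f \<in> J"
  proof (rule Suc.IH)
    show "contains_multilinear_identities n"
      using Suc.prems(1) by (rule contains_multilinear_identities_of_Suc)
    show "is_M12_star_identity (f - hom_component (Suc n) f)"
      using Suc.prems(2) top by (simp add: is_M12_star_identity_def eval_fpoly.diff)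
    show "fdeg_le (f - hom_component (Suc n) f) n"
      unfolding fdeg_le_def
    proof
      fix w assume "w \<in> Poly_Mapping.keys (f - hom_component (Suc n) f)"
      then have "w \<in> Poly_Mapping.keys f" "wdeg w \<noteq> Suc n"
        by (auto simp: in_keys_iff lookup_minus lookup_hom_component split: if_splits)
      with Suc.prems(3) show "wdeg w \<le> n"
        unfolding fdeg_le_def by (metis le_SucE)
    qed
  qed
  then show ?case
    using fpoly.subspace_add[OF subspace, of "f - hom_component (Suc n) f" "hom_component (Suc n) f"] top
    by simp
qed

end

section \<open>Consequences of the generators\<close>

definition pair_sign :: "vkind \<Rightarrow> vkind \<Rightarrow> 'a::ring_1" where
  "pair_sign k l = of_int (ksign k * ksign l)"

lemma pair_sign_square: "pair_sign k l * pair_sign k l = (1::'a::ring_1)"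
  by (simp add: pair_sign_def ksign_def)

lemma fpoly_kind_YM_anticommutator:
  assumes "fpoly_kind YM p" "fpoly_kind YM q"
  shows "fpoly_kind YP (p * q + q * p)"
  using assms fpoly_parity_mult[of False p False q] fpoly_parity_mult[of False q False p]
  by (auto simp: fpoly_kind_def kodd_def ksign_def fstar.add fstar_mult fpoly_parity_add)

lemma fpoly_kind_odd_products:
  assumes "fpoly_kind k p" "fpoly_kind l q" "kodd k" "kodd l"
  shows "fpoly_kind YP (p * q - fsmult (pair_sign k l) (q * p))"
    and "fpoly_kind YM (p * q + fsmult (pair_sign k l) (q * p))"
proof -
  have par: "fpoly_parity True p" "fpoly_parity True q"
    and star: "fstar p = fsmult (of_int (ksign k)) p" "fstar q = fsmult (of_int (ksign l)) q"
    using assms by (simp_all add: fpoly_kind_def)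
  have "fpoly_parity False (p * q)" "fpoly_parity False (q * p)"
    using fpoly_parity_mult[OF par] fpoly_parity_mult[OF par(2,1)] by simp_all
  moreover have "fstar (p * q) = - fsmult (pair_sign k l) (q * p)"
    "fstar (q * p) = - fsmult (pair_sign k l) (p * q)"
    by (simp_all add: fstar_mult[OF par] fstar_mult[OF par(2,1)] star pair_sign_def mult.commute)
  ultimately show "fpoly_kind YP (p * q - fsmult (pair_sign k l) (q * p))"
    "fpoly_kind YM (p * q + fsmult (pair_sign k l) (q * p))"
    by (simp_all add: fpoly_kind_def kodd_def ksign_def fstar.add fstar.diff fstar.scale
        pair_sign_square fpoly_parity_add fpoly_parity_diff fpoly_parity_fsmult)
qed

locale M12_T2star_ideal = T2star_ideal +
  assumes gens: "gens_I \<subseteq> J"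
begin

lemma gen_mem:
  "yp 1 * yp 2 - yp 2 * yp 1 \<in> J"
  "yp 1 * ym 1 - ym 1 * yp 1 \<in> J"
  "ym 1 * zp 1 * ym 2 \<in> J"
  "ym 1 * zm 1 * ym 2 \<in> J"
  "zp 1 * zp 2 * zp 3 + zp 2 * zp 3 * zp 1 + zp 3 * zp 1 * zp 2 \<in> J"
  "zm 1 * zm 2 * zm 3 + zm 2 * zm 3 * zm 1 + zm 3 * zm 1 * zm 2 \<in> J"
  "zp 1 * ym 1 * zp 2 - zp 2 * ym 1 * zp 1 \<in> J"
  "zm 1 * ym 1 * zm 2 - zm 2 * ym 1 * zm 1 \<in> J"
  "zp 1 * zp 2 * zm 1 - zp 2 * zm 1 * zp 1 + zm 1 * zp 1 * zp 2 \<in> J"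
  "zm 1 * zm 2 * zp 1 - zm 2 * zp 1 * zm 1 + zp 1 * zm 1 * zm 2 \<in> J"
  "zp 1 * ym 1 * zm 1 + zm 1 * ym 1 * zp 1 \<in> J"
  using gens by (simp_all add: gens_I_def)

lemmas subst_fpoly_simps = subst_fpoly.add subst_fpoly.diff subst_fpoly_mult subst_fpoly_fvar

lemma comm_YP_even_mem:
  assumes "fpoly_kind YP p" "fpoly_kind k q" "\<not> kodd k"
  shows "p * q - q * p \<in> J"
  using subst_mem[OF gen_mem(1), of "(case_prod fvar)((YP, 1) := p, (YP, 2) := q)"]
    subst_mem[OF gen_mem(2), of "(case_prod fvar)((YP, 1) := p, (YM, 1) := q)"] assms
  by (cases k) (auto simp: subst_fpoly_simps kodd_def)

lemma YM_odd_YM_mem: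
  assumes "fpoly_kind YM p" "fpoly_kind YM q" "fpoly_kind k r" "kodd k"
  shows "p * r * q \<in> J"
  using subst_mem[OF gen_mem(3), of "(case_prod fvar)((YM, 1) := p, (ZP, 1) := r, (YM, 2) := q)"]
    subst_mem[OF gen_mem(4), of "(case_prod fvar)((YM, 1) := p, (ZM, 1) := r, (YM, 2) := q)"] assms
  by (auto simp: subst_fpoly_simps kodd_def)

lemma odd_cyclic_mem:
  assumes "fpoly_kind k p" "fpoly_kind k q" "fpoly_kind l r" "kodd k" "kodd l"
  shows "p * q * r + fsmult (pair_sign k l) (q * r * p) + r * p * q \<in> J"
  using subst_mem[OF gen_mem(5), of "(case_prod fvar)((ZP, 1) := p, (ZP, 2) := q, (ZP, 3) := r)"]
    subst_mem[OF gen_mem(6), of "(case_prod fvar)((ZM, 1) := p, (ZM, 2) := q, (ZM, 3) := r)"]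
    subst_mem[OF gen_mem(9), of "(case_prod fvar)((ZP, 1) := p, (ZP, 2) := q, (ZM, 1) := r)"]
    subst_mem[OF gen_mem(10), of "(case_prod fvar)((ZM, 1) := p, (ZM, 2) := q, (ZP, 1) := r)"] assms
  by (auto simp: subst_fpoly_simps kodd_def pair_sign_def ksign_def)

lemma odd_YM_odd_mem:
  assumes "fpoly_kind YM p" "fpoly_kind k q" "fpoly_kind l r" "kodd k" "kodd l"
  shows "q * p * r - fsmult (pair_sign k l) (r * p * q) \<in> J"
  using subst_mem[OF gen_mem(7), of "(case_prod fvar)((YM, 1) := p, (ZP, 1) := q, (ZP, 2) := r)"]
    subst_mem[OF gen_mem(8), of "(case_prod fvar)((YM, 1) := p, (ZM, 1) := q, (ZM, 2) := r)"]
    subst_mem[OF gen_mem(11), of "(case_prod fvar)((YM, 1) := p, (ZP, 1) := q, (ZM, 1) := r)"]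
    subst_mem[OF gen_mem(11), of "(case_prod fvar)((YM, 1) := p, (ZP, 1) := r, (ZM, 1) := q)"] assms
  by (auto simp: subst_fpoly_simps kodd_def pair_sign_def ksign_def add.commute)

lemma comm_YP_odd_odd_mem:
  assumes "fpoly_kind YP p" "fpoly_kind k q" "fpoly_kind l r" "kodd k" "kodd l"
  shows "p * q * r - q * r * p \<in> J"
proof -
  let ?sym = "q * r - fsmult (pair_sign k l) (r * q)"
    and ?skew = "q * r + fsmult (pair_sign k l) (r * q)"
  have "p * ?sym - ?sym * p \<in> J" "p * ?skew - ?skew * p \<in> J"
    using comm_YP_even_mem[OF assms(1)] fpoly_kind_odd_products[OF assms(2-5)] by (auto simp: kodd_def)
  then have "fsmult (1/2) ((p * ?sym - ?sym * p) + (p * ?skew - ?skew * p)) \<in> J"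
    by (intro fpoly.subspace_scale[OF subspace] fpoly.subspace_add[OF subspace])
  moreover have "(p * ?sym - ?sym * p) + (p * ?skew - ?skew * p)
      = (p * q * r - q * r * p) + (p * q * r - q * r * p)"
    by (simp add: algebra_simps)
  moreover have "fsmult (1/2) (x + x) = x" for x :: "'a fpoly"
    by (simp add: fpoly.scale_right_distrib flip: fpoly.scale_left_distrib)
  ultimately show ?thesis by metis
qed

end

section \<open>Multilinear identities of degree three\<close>

definition cubic :: "'a::comm_ring_1 \<Rightarrow> 'a \<Rightarrow> 'a \<Rightarrow> 'a \<Rightarrow> 'a \<Rightarrow> 'a \<Rightarrow>
    'a fpoly \<Rightarrow> 'a fpoly \<Rightarrow> 'a fpoly \<Rightarrow> 'a fpoly" where
  "cubic c123 c132 c213 c231 c312 c321 p q r =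
     fsmult c123 (p * q * r) + fsmult c132 (p * r * q) + fsmult c213 (q * p * r)
     + fsmult c231 (q * r * p) + fsmult c312 (r * p * q) + fsmult c321 (r * q * p)"

definition matrix_cubic :: "'a::comm_ring_1 \<Rightarrow> 'a \<Rightarrow> 'a \<Rightarrow> 'a \<Rightarrow> 'a \<Rightarrow> 'a \<Rightarrow>
    'a^'n^'n \<Rightarrow> 'a^'n^'n \<Rightarrow> 'a^'n^'n \<Rightarrow> 'a^'n^'n" where
  "matrix_cubic c123 c132 c213 c231 c312 c321 A B C =
     matrix_scale c123 (A ** B ** C) + matrix_scale c132 (A ** C ** B) + matrix_scale c213 (B ** A ** C)
     + matrix_scale c231 (B ** C ** A) + matrix_scale c312 (C ** A ** B) + matrix_scale c321 (C ** B ** A)"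

lemma eval_fpoly_cubic:
  "eval_fpoly \<sigma> (cubic c123 c132 c213 c231 c312 c321 p q r)
    = matrix_cubic c123 c132 c213 c231 c312 c321 (eval_fpoly \<sigma> p) (eval_fpoly \<sigma> q) (eval_fpoly \<sigma> r)"
  by (simp add: cubic_def matrix_cubic_def eval_fpoly.add eval_fpoly.scale eval_fpoly_mult)

definition cubic_identity :: "vkind \<Rightarrow> vkind \<Rightarrow> vkind \<Rightarrow>
    'a::field \<Rightarrow> 'a \<Rightarrow> 'a \<Rightarrow> 'a \<Rightarrow> 'a \<Rightarrow> 'a \<Rightarrow> bool" where
  "cubic_identity k l m c123 c132 c213 c231 c312 c321 \<longleftrightarrow>
     (\<forall>A B C. mat_kind k A \<longrightarrow> mat_kind l B \<longrightarrow> mat_kind m C \<longrightarrow>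
        matrix_cubic c123 c132 c213 c231 c312 c321 A B C = 0)"

lemma permutations_of_set_tripleton:
  assumes "x \<noteq> y" "x \<noteq> z" "y \<noteq> z"
  shows "permutations_of_set {x, y, z}
    = {[x, y, z], [x, z, y], [y, x, z], [y, z, x], [z, x, y], [z, y, x]}"
proof -
  have "permutations_of_set {x, y, z} = (\<Union>u\<in>{x, y, z}. (#) u ` permutations_of_set ({x, y, z} - {u}))"
    by (rule permutations_of_set_nonempty) simp
  also have "\<dots> = (#) x ` permutations_of_set {y, z} \<union> (#) y ` permutations_of_set {x, z}
      \<union> (#) z ` permutations_of_set {x, y}"
    using assms by (simp add: insert_Diff_if insert_commute Un_assoc)
  finally show ?thesis
    using assms by (auto simp: permutations_of_set_doubleton)
qed

lemma multilinear_three_eq_cubic: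
  "multilinear c [k, l, m] = cubic (c [0, 1, 2]) (c [0, 2, 1]) (c [1, 0, 2]) (c [1, 2, 0])
     (c [2, 0, 1]) (c [2, 1, 0]) (fvar k 0) (fvar l 1) (fvar m 2)"
proof -
  have positions: "{..<length [k, l, m]} = {0, 1, 2}"
    by auto
  show ?thesis
    unfolding multilinear_def positions
    by (simp add: permutations_of_set_tripleton cubic_def fvar_def mult_single)
qed

lemma M12_star_identity_cubicD:
  assumes "is_M12_star_identity (cubic c123 c132 c213 c231 c312 c321 (fvar k 0) (fvar l 1) (fvar m 2))"
  shows "cubic_identity k l m c123 c132 c213 c231 c312 c321"
  unfolding cubic_identity_def
proof (intro allI impI)
  fix A B C :: "'a^3^3"
  assume kinds: "mat_kind k A" "mat_kind l B" "mat_kind m C"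
  define \<sigma> :: "var \<Rightarrow> 'a^3^3" where "\<sigma> = (\<lambda>_. 0)((k, 0) := A, (l, 1) := B, (m, 2) := C)"
  have "M12_admissible \<sigma>"
    using kinds by (auto simp: M12_admissible_iff \<sigma>_def mat_kind_zero)
  with assms have "eval_fpoly \<sigma> (cubic c123 c132 c213 c231 c312 c321 (fvar k 0) (fvar l 1) (fvar m 2)) = 0"
    by (simp add: is_M12_star_identity_def)
  then show "matrix_cubic c123 c132 c213 c231 c312 c321 A B C = 0"
    by (simp add: eval_fpoly_cubic eval_fpoly_fvar \<sigma>_def)
qed

definition mat3 :: "'a \<Rightarrow> 'a \<Rightarrow> 'a \<Rightarrow> 'a \<Rightarrow> 'a \<Rightarrow> 'a \<Rightarrow> 'a \<Rightarrow> 'a \<Rightarrow> 'a \<Rightarrow> 'a::zero^3^3" where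
  "mat3 a b c d e f g h i = vector [vector [a, b, c], vector [d, e, f], vector [g, h, i]]"

lemma mat3_nth [simp]:
  "mat3 a b c d e f g h i $ 1 = vector [a, b, c]"
  "mat3 a b c d e f g h i $ 2 = vector [d, e, f]"
  "mat3 a b c d e f g h i $ 3 = vector [g, h, i]"
  by (simp_all add: mat3_def)

lemma mat3_mult [simp]:
  "mat3 a b c d e f g h i ** mat3 a' b' c' d' e' f' g' h' i' =
   mat3 (a*a' + b*d' + c*g') (a*b' + b*e' + c*h') (a*c' + b*f' + c*i')
        (d*a' + e*d' + f*g') (d*b' + e*e' + f*h') (d*c' + e*f' + f*i')
        (g*a' + h*d' + i*g') (g*b' + h*e' + i*h') (g*c' + h*f' + i*i')"
  for a :: "'a::field"
  by (simp add: matrix3_eq_iff matrix_matrix_mult_def sum_3)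

abbreviation e11 :: "'a::field^3^3" where "e11 \<equiv> mat3 1 0 0 0 0 0 0 0 0"
abbreviation e23 :: "'a::field^3^3" where "e23 \<equiv> mat3 0 0 0 0 0 1 0 0 0"
abbreviation e32 :: "'a::field^3^3" where "e32 \<equiv> mat3 0 0 0 0 0 0 0 1 0"

definition even_diag :: "vkind \<Rightarrow> 'a::field^3^3" where
  "even_diag k = mat3 0 0 0 0 1 0 0 0 (of_int (ksign k))"

definition odd_mat :: "vkind \<Rightarrow> 'a::field \<Rightarrow> 'a \<Rightarrow> 'a^3^3" where
  "odd_mat k b c = mat3 0 b c (of_int (ksign k) * c) 0 0 (- of_int (ksign k) * b) 0 0"

lemma mat_kind_units: "mat_kind YP e11" "mat_kind YM e23" "mat_kind YM e32"
  by (simp_all add: mat_kind_def kodd_def ksign_def M12_even_def M12_star_def matrix3_eq_iff)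

lemma mat_kind_even_diag: "\<not> kodd k \<Longrightarrow> mat_kind k (even_diag k)"
  by (cases k) (simp_all add: mat_kind_def kodd_def ksign_def M12_even_def M12_star_def
      matrix3_eq_iff even_diag_def)

lemma mat_kind_odd_mat: "kodd k \<Longrightarrow> mat_kind k (odd_mat k b c)"
  by (cases k) (simp_all add: mat_kind_def kodd_def ksign_def M12_odd_def M12_star_def
      matrix3_eq_iff odd_mat_def)

lemma cubic_identity_entry:
  assumes "cubic_identity k l m c123 c132 c213 c231 c312 c321"
    and "mat_kind k A" "mat_kind l B" "mat_kind m C"
  shows "c123 * (A ** B ** C) $ i $ j + c132 * (A ** C ** B) $ i $ j + c213 * (B ** A ** C) $ i $ j
    + c231 * (B ** C ** A) $ i $ j + c312 * (C ** A ** B) $ i $ j + c321 * (C ** B ** A) $ i $ j = 0"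
proof -
  have "matrix_cubic c123 c132 c213 c231 c312 c321 A B C $ i $ j = 0"
    using assms by (simp add: cubic_identity_def)
  then show ?thesis
    by (simp add: matrix_cubic_def)
qed

lemma cubic_identity_YP_YP_even:
  assumes ident: "cubic_identity YP YP k c123 c132 c213 c231 c312 c321" and k: "\<not> kodd k"
  shows "c123 + c132 + c213 + c231 + c312 + c321 = 0"
  using cubic_identity_entry[OF ident mat_kind_even_diag mat_kind_even_diag mat_kind_even_diag[OF k],
      where i = 2 and j = 2]
  by (simp add: even_diag_def)

lemma cubic_identity_YP_YM_YM:
  assumes ident: "cubic_identity YP YM YM c123 c132 c213 c231 c312 c321"
  shows "c123 + c213 + c231 = 0" "c132 + c312 + c321 = 0"
proof -
  note entry = cubic_identity_entry[OF ident mat_kind_even_diag mat_kind_units(2,3),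
      unfolded even_diag_def, simplified]
  show "c123 + c213 + c231 = 0" "c132 + c312 + c321 = 0"
    using entry[of 2 2] entry[of 3 3] by simp_all
qed

lemma cubic_identity_YM_YM_YM:
  assumes ident: "cubic_identity YM YM YM c123 c132 c213 c231 c312 c321"
  shows "c123 = c213 - c231" "c132 = - c231" "c312 = - c213" "c321 = c231 - c213"
proof -
  have diag: "mat_kind YM (even_diag YM)"
    by (simp add: mat_kind_even_diag)
  note e23 = mat_kind_units(2) and e32 = mat_kind_units(3)
  note at_e23_e32_diag = cubic_identity_entry[OF ident e23 e32 diag, unfolded even_diag_def, simplified]
    and at_e23_diag_e32 = cubic_identity_entry[OF ident e23 diag e32, unfolded even_diag_def, simplified]
    and at_diag_e23_e32 = cubic_identity_entry[OF ident diag e23 e32, unfolded even_diag_def, simplified]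
  have "c123 - c132 + c312 = 0" "c231 - c213 - c321 = 0"
    using at_e23_e32_diag[of 2 2] at_e23_e32_diag[of 3 3] by simp_all
  moreover have "c132 - c123 + c213 = 0" "- c231 - c312 + c321 = 0"
    using at_e23_diag_e32[of 2 2] at_e23_diag_e32[of 3 3] by simp_all
  moreover have "c123 - c213 + c231 = 0" "c312 - c132 - c321 = 0"
    using at_diag_e23_e32[of 2 2] at_diag_e23_e32[of 3 3] by simp_all
  ultimately show "c123 = c213 - c231" "c132 = - c231" "c312 = - c213" "c321 = c231 - c213"
    by algebra+
qed

lemma cubic_identity_YP_even_odd:
  fixes c123 :: "'a::field"
  assumes ident: "cubic_identity YP k l c123 c132 c213 c231 c312 c321"
    and k: "\<not> kodd k" and l: "kodd l"
  shows "c213 = - c123" "c321 = - c312" "c132 = 0" "c231 = 0"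
proof -
  note even = mat_kind_even_diag[OF k] and odd = mat_kind_odd_mat[OF l, of 1 0]
  note unit = cubic_identity_entry[OF ident mat_kind_units(1) even odd,
      unfolded even_diag_def odd_mat_def, simplified]
    and diag = cubic_identity_entry[OF ident mat_kind_even_diag even odd,
      unfolded even_diag_def odd_mat_def, simplified]
  show "c213 = - c123" "c321 = - c312" "c132 = 0" "c231 = 0"
    using diag[of 3 1, simplified] diag[of 1 2, simplified] unit[of 1 2, simplified]
      unit[of 3 1, simplified] ksign_square[of k, where 'a = 'a] ksign_square[of l, where 'a = 'a]
    by algebra+
qed

lemma cubic_identity_YM_YM_odd:
  fixes c123 :: "'a::field"
  assumes ident: "cubic_identity YM YM k c123 c132 c213 c231 c312 c321" and k: "kodd k"
  shows "c123 = 0" "c213 = 0" "c312 = 0" "c321 = 0"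
proof -
  note k10 = mat_kind_odd_mat[OF k, of 1 0] and k01 = mat_kind_odd_mat[OF k, of 0 1]
  note at_k10 = cubic_identity_entry[OF ident mat_kind_units(2,3) k10, unfolded odd_mat_def, simplified]
    and at_k01 = cubic_identity_entry[OF ident mat_kind_units(2,3) k01, unfolded odd_mat_def, simplified]
  show "c123 = 0" "c213 = 0" "c312 = 0" "c321 = 0"
    using at_k01[of 2 1, simplified] at_k10[of 3 1, simplified] at_k10[of 1 2, simplified]
      at_k01[of 1 3, simplified] ksign_square[of k, where 'a = 'a]
    by algebra+
qed

lemma cubic_identity_YP_odd_odd:
  fixes c123 :: "'a::field"
  assumes ident: "cubic_identity YP k l c123 c132 c213 c231 c312 c321"
    and k: "kodd k" and l: "kodd l"
  shows "c231 = - c123" "c321 = - c132" "c213 = 0" "c312 = 0"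
proof -
  note k10 = mat_kind_odd_mat[OF k, of 1 0] and l01 = mat_kind_odd_mat[OF l, of 0 1]
  note unit = cubic_identity_entry[OF ident mat_kind_units(1) k10 l01, unfolded odd_mat_def, simplified]
    and diag = cubic_identity_entry[OF ident mat_kind_even_diag k10 l01,
      unfolded even_diag_def odd_mat_def, simplified]
  show "c231 = - c123" "c321 = - c132" "c213 = 0" "c312 = 0"
    using diag[of 3 3, simplified] diag[of 2 2, simplified] unit[of 3 3, simplified]
      unit[of 2 2, simplified] ksign_square[of k, where 'a = 'a] ksign_square[of l, where 'a = 'a]
    by algebra+
qed

lemma cubic_identity_YM_odd_odd:
  fixes c123 :: "'a::field"
  assumes ident: "cubic_identity YM k l c123 c132 c213 c231 c312 c321"
    and k: "kodd k" and l: "kodd l"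
  shows "c132 = - (pair_sign k l * c123)" "c231 = - c123" "c321 = pair_sign k l * c123"
    "c312 = - (pair_sign k l * c213)"
proof -
  note k10 = mat_kind_odd_mat[OF k, of 1 0] and l01 = mat_kind_odd_mat[OF l, of 0 1]
  note unit = cubic_identity_entry[OF ident mat_kind_units(2) k10 l01, unfolded odd_mat_def, simplified]
    and diag = cubic_identity_entry[OF ident mat_kind_even_diag k10 l01,
      unfolded even_diag_def odd_mat_def, simplified]
  show "c132 = - (pair_sign k l * c123)" "c231 = - c123" "c321 = pair_sign k l * c123"
    "c312 = - (pair_sign k l * c213)"
    unfolding pair_sign_def of_int_mult
    using unit[of 2 3, simplified] diag[of 1 1, simplified] diag[of 2 2, simplified]
      diag[of 3 3, simplified] ksign_square[of k, where 'a = 'a] ksign_square[of l, where 'a = 'a]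
    by algebra+
qed

lemma cubic_identity_odd_odd_odd:
  fixes c123 :: "'a::field_char_0"
  assumes ident: "cubic_identity k k l c123 c132 c213 c231 c312 c321"
    and k: "kodd k" and l: "kodd l"
  shows "c231 = pair_sign k l * c123" "c312 = c123" "c132 = pair_sign k l * c213" "c321 = c213"
proof -
  note k10 = mat_kind_odd_mat[OF k, of 1 0] and k01 = mat_kind_odd_mat[OF k, of 0 1]
    and l10 = mat_kind_odd_mat[OF l, of 1 0] and l01 = mat_kind_odd_mat[OF l, of 0 1]
  note at_l01 = cubic_identity_entry[OF ident k10 k10 l01, unfolded odd_mat_def, simplified]
    and at_l10 = cubic_identity_entry[OF ident k10 k01 l10, unfolded odd_mat_def, simplified]
  have "pair_sign k l * (c132 + c231) = c312 + c321"
    "pair_sign k l * (c123 + c213) = c132 + c231"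
    "c123 + c321 = c213 + pair_sign k l * c231"
    "pair_sign k l * (c123 + c321) = c132 + pair_sign k l * c312"
    unfolding pair_sign_def of_int_mult
    using at_l01[of 1 2, simplified] at_l01[of 3 1, simplified] at_l10[of 1 2, simplified]
      at_l10[of 3 1, simplified] ksign_square[of k, where 'a = 'a] ksign_square[of l, where 'a = 'a]
    by algebra+
  then have "3 * c321 = 3 * c213" "c231 = pair_sign k l * (c123 + c321 - c213)"
    "c312 = c123 + c213 - c321" "c132 = pair_sign k l * c321"
    using pair_sign_square[of k l, where 'a = 'a] by algebra+
  then show "c231 = pair_sign k l * c123" "c312 = c123" "c132 = pair_sign k l * c213" "c321 = c213"
    by simp_all
qed

section \<open>Multilinear identities of degree three lie in the ideal\<close>

context M12_T2star_ideal
begin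

lemma cubic_mem_YP_YP_even:
  assumes ident: "cubic_identity YP YP k c123 c132 c213 c231 c312 c321"
    and p: "fpoly_kind YP p" and q: "fpoly_kind YP q" and r: "fpoly_kind k r"
    and k: "\<not> kodd k"
  shows "cubic c123 c132 c213 c231 c312 c321 p q r \<in> J"
proof -
  have coeffs: "c321 = - (c123 + c132 + c213 + c231 + c312)"
    using cubic_identity_YP_YP_even[OF ident k] by algebra
  have "cubic c123 c132 c213 c231 c312 c321 p q r
      = fsmult c123 ((p * q - q * p) * r) + fsmult (c123 + c213) (q * (p * r - r * p))
        + fsmult (c123 + c213 + c231) ((q * r - r * q) * p) + fsmult c132 ((p * r - r * p) * q)
        + fsmult (c132 + c312) (r * (p * q - q * p))"
    by (simp add: cubic_def coeffs algebra_simps)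
  moreover have "p * q - q * p \<in> J" "p * r - r * p \<in> J" "q * r - r * q \<in> J"
    using p q r k by (simp_all add: comm_YP_even_mem)
  ultimately show ?thesis
    by (simp add: mem_intros)
qed

lemma cubic_mem_YP_YM_YM:
  assumes ident: "cubic_identity YP YM YM c123 c132 c213 c231 c312 c321"
    and p: "fpoly_kind YP p" and q: "fpoly_kind YM q" and r: "fpoly_kind YM r"
  shows "cubic c123 c132 c213 c231 c312 c321 p q r \<in> J"
proof -
  have coeffs: "c231 = - (c123 + c213)" "c321 = - (c132 + c312)"
    using cubic_identity_YP_YM_YM[OF ident] by algebra+
  have "cubic c123 c132 c213 c231 c312 c321 p q r
      = fsmult c123 ((p * q - q * p) * r) + fsmult (c123 + c213) (q * (p * r - r * p))
        + fsmult c132 ((p * r - r * p) * q) + fsmult (c132 + c312) (r * (p * q - q * p))"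
    by (simp add: cubic_def coeffs algebra_simps)
  moreover have "p * q - q * p \<in> J" "p * r - r * p \<in> J"
    using p q r by (simp_all add: comm_YP_even_mem)
  ultimately show ?thesis
    by (simp add: mem_intros)
qed

lemma cubic_mem_YM_YM_YM:
  assumes ident: "cubic_identity YM YM YM c123 c132 c213 c231 c312 c321"
    and p: "fpoly_kind YM p" and q: "fpoly_kind YM q" and r: "fpoly_kind YM r"
  shows "cubic c123 c132 c213 c231 c312 c321 p q r \<in> J"
proof -
  have "cubic c123 c132 c213 c231 c312 c321 p q r
      = fsmult c213 ((p * q + q * p) * r - r * (p * q + q * p))
        + fsmult c231 ((q * r + r * q) * p - p * (q * r + r * q))"
    by (simp add: cubic_def cubic_identity_YM_YM_YM[OF ident] algebra_simps)
  moreover have "(p * q + q * p) * r - r * (p * q + q * p) \<in> J"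
    "(q * r + r * q) * p - p * (q * r + r * q) \<in> J"
    using p q r by (simp_all add: comm_YP_even_mem fpoly_kind_YM_anticommutator)
  ultimately show ?thesis
    by (simp only: mem_intros)
qed

lemma cubic_mem_YP_even_odd:
  assumes ident: "cubic_identity YP k l c123 c132 c213 c231 c312 c321"
    and p: "fpoly_kind YP p" and q: "fpoly_kind k q" and k: "\<not> kodd k" and l: "kodd l"
  shows "cubic c123 c132 c213 c231 c312 c321 p q r \<in> J"
proof -
  have "cubic c123 c132 c213 c231 c312 c321 p q r
      = fsmult c123 ((p * q - q * p) * r) + fsmult c312 (r * (p * q - q * p))"
    by (simp add: cubic_def cubic_identity_YP_even_odd[OF ident k l] algebra_simps)
  moreover have "p * q - q * p \<in> J"
    using p q k by (rule comm_YP_even_mem)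
  ultimately show ?thesis
    by (simp add: mem_intros)
qed

lemma cubic_mem_YM_YM_odd:
  assumes ident: "cubic_identity YM YM k c123 c132 c213 c231 c312 c321"
    and p: "fpoly_kind YM p" and q: "fpoly_kind YM q" and r: "fpoly_kind k r" and k: "kodd k"
  shows "cubic c123 c132 c213 c231 c312 c321 p q r \<in> J"
  unfolding cubic_def
  by (simp add: cubic_identity_YM_YM_odd[OF ident k] mem_intros
      YM_odd_YM_mem[OF p q r k] YM_odd_YM_mem[OF q p r k])

lemma cubic_mem_YP_odd_odd:
  assumes ident: "cubic_identity YP k l c123 c132 c213 c231 c312 c321"
    and p: "fpoly_kind YP p" and q: "fpoly_kind k q" and r: "fpoly_kind l r"
    and k: "kodd k" and l: "kodd l"
  shows "cubic c123 c132 c213 c231 c312 c321 p q r \<in> J"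
proof -
  have "cubic c123 c132 c213 c231 c312 c321 p q r
      = fsmult c123 (p * q * r - q * r * p) + fsmult c132 (p * r * q - r * q * p)"
    by (simp add: cubic_def cubic_identity_YP_odd_odd[OF ident k l] algebra_simps)
  then show ?thesis
    using comm_YP_odd_odd_mem[OF p q r k l] comm_YP_odd_odd_mem[OF p r q l k] by (simp only: mem_intros)
qed

lemma cubic_mem_YM_odd_odd:
  assumes ident: "cubic_identity YM k l c123 c132 c213 c231 c312 c321"
    and p: "fpoly_kind YM p" and q: "fpoly_kind k q" and r: "fpoly_kind l r"
    and k: "kodd k" and l: "kodd l"
  shows "cubic c123 c132 c213 c231 c312 c321 p q r \<in> J"
proof -
  let ?s = "q * r - fsmult (pair_sign k l) (r * q)"
  have "cubic c123 c132 c213 c231 c312 c321 p q r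
      = fsmult (- c123) (?s * p - p * ?s) + fsmult c213 (q * p * r - fsmult (pair_sign k l) (r * p * q))"
    by (simp add: cubic_def cubic_identity_YM_odd_odd[OF ident k l] algebra_simps)
  moreover have "?s * p - p * ?s \<in> J"
    using fpoly_kind_odd_products(1)[OF q r k l] p by (rule comm_YP_even_mem) simp
  ultimately show ?thesis
    using odd_YM_odd_mem[OF p q r k l] by (simp only: mem_intros)
qed

lemma cubic_mem_odd_odd_odd:
  assumes ident: "cubic_identity k k l c123 c132 c213 c231 c312 c321"
    and p: "fpoly_kind k p" and q: "fpoly_kind k q" and r: "fpoly_kind l r"
    and k: "kodd k" and l: "kodd l"
  shows "cubic c123 c132 c213 c231 c312 c321 p q r \<in> J"
proof -
  have "cubic c123 c132 c213 c231 c312 c321 p q r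
      = fsmult c123 (p * q * r + fsmult (pair_sign k l) (q * r * p) + r * p * q)
        + fsmult c213 (q * p * r + fsmult (pair_sign k l) (p * r * q) + r * q * p)"
    by (simp add: cubic_def cubic_identity_odd_odd_odd[OF ident k l] algebra_simps)
  then show ?thesis
    using odd_cyclic_mem[OF p q r k l] odd_cyclic_mem[OF q p r k l] by (simp only: mem_intros)
qed

definition cubic_complete :: "vkind \<Rightarrow> vkind \<Rightarrow> vkind \<Rightarrow> bool" where
  "cubic_complete k l m \<longleftrightarrow> (\<forall>c123 c132 c213 c231 c312 c321 p q r.
     cubic_identity k l m c123 c132 c213 c231 c312 c321 \<longrightarrow>
     fpoly_kind k p \<longrightarrow> fpoly_kind l q \<longrightarrow> fpoly_kind m r \<longrightarrow>
     cubic c123 c132 c213 c231 c312 c321 p q r \<in> J)"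

lemma cubic_complete_swap12:
  assumes "cubic_complete k l m"
  shows "cubic_complete l k m"
proof -
  have "cubic c123 c132 c213 c231 c312 c321 p q r = cubic c213 c231 c123 c132 c321 c312 q p r"
    for c123 c132 c213 c231 c312 c321 :: 'a and p q r
    by (simp add: cubic_def add_ac)
  moreover have "cubic_identity l k m c123 c132 c213 c231 c312 c321 \<Longrightarrow>
      cubic_identity k l m c213 c231 c123 c132 c321 c312"
    for c123 c132 c213 c231 c312 c321 :: 'a
    by (simp add: cubic_identity_def matrix_cubic_def add_ac)
  ultimately show ?thesis
    using assms unfolding cubic_complete_def by metis
qed

lemma cubic_complete_swap23:
  assumes "cubic_complete k l m"
  shows "cubic_complete k m l"
proof -
  have "cubic c123 c132 c213 c231 c312 c321 p q r = cubic c132 c123 c312 c321 c213 c231 p r q"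
    for c123 c132 c213 c231 c312 c321 :: 'a and p q r
    by (simp add: cubic_def add_ac)
  moreover have "cubic_identity k m l c123 c132 c213 c231 c312 c321 \<Longrightarrow>
      cubic_identity k l m c132 c123 c312 c321 c213 c231"
    for c123 c132 c213 c231 c312 c321 :: 'a
    by (simp add: cubic_identity_def matrix_cubic_def add_ac)
  ultimately show ?thesis
    using assms unfolding cubic_complete_def by metis
qed

lemma cubic_complete_all: "cubic_complete k l m"
proof -
  have even: "cubic_complete YP YP YP" "cubic_complete YP YP YM"
    "cubic_complete YP YM YM" "cubic_complete YM YM YM"
    unfolding cubic_complete_def
    using cubic_mem_YP_YP_even cubic_mem_YP_YM_YM cubic_mem_YM_YM_YM by simp_all
  have one_odd: "cubic_complete YP YP k" "cubic_complete YP YM k" "cubic_complete YM YM k"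
    if "kodd k" for k
    unfolding cubic_complete_def using that cubic_mem_YP_even_odd cubic_mem_YM_YM_odd by simp_all
  have two_odd: "cubic_complete YP k l" "cubic_complete YM k l" if "kodd k" "kodd l" for k l
    unfolding cubic_complete_def using that cubic_mem_YP_odd_odd cubic_mem_YM_odd_odd by simp_all
  have odd: "cubic_complete k k l" if "kodd k" "kodd l" for k l
    unfolding cubic_complete_def using that cubic_mem_odd_odd_odd by simp
  note sorted = even one_odd[OF kodd_simps(3)] one_odd[OF kodd_simps(4)]
    two_odd[OF kodd_simps(3) kodd_simps(3)] two_odd[OF kodd_simps(3) kodd_simps(4)]
    two_odd[OF kodd_simps(4) kodd_simps(4)] odd[OF kodd_simps(3) kodd_simps(3)]
    odd[OF kodd_simps(3) kodd_simps(4)] odd[OF kodd_simps(4) kodd_simps(3)]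
    odd[OF kodd_simps(4) kodd_simps(4)]
  have permute: "cubic_complete k m l \<and> cubic_complete l k m \<and> cubic_complete l m k
      \<and> cubic_complete m k l \<and> cubic_complete m l k" if "cubic_complete k l m" for k l m
    using that by (blast intro: cubic_complete_swap12 cubic_complete_swap23)
  show ?thesis
    by (cases k; cases l; cases m) (simp_all add: sorted sorted[THEN permute])
qed

lemma identity_of_degree_le_3_mem:
  assumes "is_M12_star_identity f" "fdeg_le f 3"
  shows "f \<in> J"
proof (rule identity_mem_of_multilinear[OF _ assms])
  show "contains_multilinear_identities 3"
    unfolding contains_multilinear_identities_def
  proof (intro allI impI)
    fix c :: "nat list \<Rightarrow> 'a" and ks :: "vkind list"
    assume "length ks = 3" and ident: "is_M12_star_identity (multilinear c ks)"
    then obtain k l m where ks: "ks = [k, l, m]"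
      by (auto simp: numeral_3_eq_3 length_Suc_conv)
    show "multilinear c ks \<in> J"
      using cubic_complete_all[of k l m]
        M12_star_identity_cubicD[OF ident[unfolded ks multilinear_three_eq_cubic]]
      unfolding ks multilinear_three_eq_cubic cubic_complete_def by simp
  qed
qed

end

theorem theorem4p8:
  fixes f :: "'a::field_char_0 fpoly"
  assumes "is_M12_star_identity f"
    and "fdeg_le f 3"
  shows "f \<in> T2star_ideal_gen gens_I"
  unfolding T2star_ideal_gen_def
proof (rule InterI)
  fix J :: "'a fpoly set"
  assume "J \<in> {J. is_T2star_ideal J \<and> gens_I \<subseteq> J}"
  then interpret M12_T2star_ideal J
    by unfold_locales auto
  show "f \<in> J"
    using assms by (rule identity_of_degree_le_3_mem)
qed

end
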